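(* Let $\mathcal{H}$ be a complex Hilbert space. For an operator $T\in\mathcal{B}(\mathcal{H})$ the following statements are equivalent: (i) $T$ is a quasicontraction; (ii) $T$ admits a left invertible quasi-isometric lifting $Q$ on a space $\mathcal{M}\supset\mathcal{H}$ such that $\mathcal{M}\ominus\mathcal{H}\subset\mathcal{N}(Q^*Q-I)$; (iii) there exists an invertible operator $A\in\mathcal{B}(\mathcal{H})$ such that $T^*T=T^*AT\le A$. Moreover, the operator $Q$ in (ii) can be chosen to be a minimal lifting for $T$.
   Context: $\mathcal{B}(\mathcal{H})$ is the algebra of bounded operators on $\mathcal{H}$; $\mathcal{N}(X)$ is the kernel of $X$; $B\le C$ means $C-B$ is positive. $T$ is a quasicontraction if $T^{*2}T^2\le T^*T$; an operator $Q$ is a quasi-isometry (quasi-isometric) if $Q^{*2}Q^2=Q^*Q$. When $\mathcal{M}\supset\mathcal{H}$ is a Hilbert space containing $\mathcal{H}$ as a closed subspace and $P_{\mathcal{M},\mathcal{H}}:\mathcal{M}\to\mathcal{H}$ is the orthogonal projection, $Q\in\mathcal{B}(\mathcal{M})$ is a lifting for $T$ if $P_{\mathcal{M},\mathcal{H}}Q=TP_{\mathcal{M},\mathcal{H}}$; it is minimal if $\mathcal{M}$ is the closed linear span of $\bigcup_{n\ge0}Q^n\mathcal{H}$. $Q$ is left invertible if it is injective with closed range, equivalently $Q^*Q$ is invertible. *)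

theory Defs
  imports "HOL-Analysis.Analysis"
begin

section \<open>Complex Hilbert spaces\<close>

text \<open>
  The complex inner product is linear in its first argument. Basing the class on
  \<^class>\<open>real_inner\<close>, with the real inner product as the real part of the complex one,
  provides norm, metric and topology.
\<close>

class complex_inner = real_inner +
  fixes scaleC :: "complex \<Rightarrow> 'a \<Rightarrow> 'a"  (infixr \<open>*\<^sub>C\<close> 75)
    and cinner :: "'a \<Rightarrow> 'a \<Rightarrow> complex"
  assumes scaleC_add_right: "a *\<^sub>C (x + y) = a *\<^sub>C x + a *\<^sub>C y"
    and scaleC_add_left: "(a + b) *\<^sub>C x = a *\<^sub>C x + b *\<^sub>C x"
    and scaleC_scaleC: "a *\<^sub>C b *\<^sub>C x = (a * b) *\<^sub>C x"
    and scaleR_scaleC: "r *\<^sub>R x = complex_of_real r *\<^sub>C x"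
    and cinner_commute: "cinner x y = cnj (cinner y x)"
    and cinner_add_left: "cinner (x + y) z = cinner x z + cinner y z"
    and cinner_scaleC_left: "cinner (a *\<^sub>C x) y = a * cinner x y"
    and inner_eq_Re_cinner: "inner x y = Re (cinner x y)"

class chilbert_space = complex_inner + complete_space

lemma scaleC_one: "1 *\<^sub>C x = (x :: 'a::complex_inner)"
  using scaleR_scaleC[of 1 x] by simp

lemma vector_space_scaleC:
  "vector_space (scaleC :: complex \<Rightarrow> 'a::complex_inner \<Rightarrow> 'a)"
  by unfold_locales (simp_all add: scaleC_add_right scaleC_add_left scaleC_scaleC scaleC_one)

abbreviation csubspace :: "'a::complex_inner set \<Rightarrow> bool" where
  "csubspace \<equiv> module.subspace scaleC"

abbreviation cspan :: "'a::complex_inner set \<Rightarrow> 'a set" where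
  "cspan \<equiv> module.span scaleC"

abbreviation clinear :: "('a::complex_inner \<Rightarrow> 'b::complex_inner) \<Rightarrow> bool" where
  "clinear \<equiv> Vector_Spaces.linear scaleC scaleC"

lemma cinner_self: "cinner x x = complex_of_real ((norm (x :: 'a::complex_inner))\<^sup>2)"
proof -
  have "Im (cinner x x) = 0"
    using arg_cong[OF cinner_commute[of x x], of Im] by simp
  then show ?thesis
    by (simp add: complex_eq_iff power2_norm_eq_inner inner_eq_Re_cinner)
qed

lemma cinner_scaleC_right: "cinner x (a *\<^sub>C y) = cnj a * cinner x (y :: 'a::complex_inner)"
  by (metis cinner_commute cinner_scaleC_left complex_cnj_mult)

lemma cinner_add_right: "cinner x (y + z) = cinner x y + cinner x (z :: 'a::complex_inner)"
  by (metis cinner_commute cinner_add_left complex_cnj_add)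

lemma norm_scaleC: "norm (a *\<^sub>C x) = cmod a * norm (x :: 'a::complex_inner)"
proof -
  have "complex_of_real ((norm (a *\<^sub>C x))\<^sup>2) = a * cnj a * cinner x x"
    by (simp only: cinner_self[symmetric] cinner_scaleC_left cinner_scaleC_right
        mult.assoc mult.left_commute)
  also have "\<dots> = complex_of_real ((cmod a * norm x)\<^sup>2)"
    by (simp add: cinner_self complex_norm_square[symmetric] power_mult_distrib)
  finally have "(norm (a *\<^sub>C x))\<^sup>2 = (cmod a * norm x)\<^sup>2"
    using of_real_eq_iff by blast
  then show ?thesis
    by (simp add: power2_eq_iff_nonneg)
qed

lemma norm_cinner_le: "cmod (cinner x y) \<le> norm x * norm (y :: 'a::complex_inner)"
proof (cases "cinner x y = 0")
  case False
  define c where "c = cnj (cinner x y) / cmod (cinner x y)"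
  have c: "cmod c = 1" using False by (simp add: c_def norm_divide)
  have "c * cinner x y = complex_of_real (cmod (cinner x y))"
    using False unfolding c_def
    by (simp add: complex_norm_square[symmetric] mult.commute power2_eq_square)
  then have "cmod (cinner x y) = inner (c *\<^sub>C x) y"
    by (simp add: inner_eq_Re_cinner cinner_scaleC_left)
  also have "\<dots> \<le> norm (c *\<^sub>C x) * norm y" by (rule norm_cauchy_schwarz)
  also have "\<dots> = norm x * norm y" by (simp add: norm_scaleC c)
  finally show ?thesis .
qed simp

instantiation complex :: chilbert_space
begin
definition scaleC_complex :: "complex \<Rightarrow> complex \<Rightarrow> complex" where
  "scaleC_complex a x = a * x"
definition cinner_complex :: "complex \<Rightarrow> complex \<Rightarrow> complex" where
  "cinner_complex x y = x * cnj y"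
instance
  by standard
    (auto simp: scaleC_complex_def cinner_complex_def algebra_simps inner_complex_def scaleR_conv_of_real)
end


section \<open>Operators on a closed subspace\<close>

text \<open>
  A Hilbert space is represented as a closed complex subspace \<open>M\<close> of a type of class
  \<^class>\<open>chilbert_space\<close> (possibly \<open>M = UNIV\<close>). An operator on \<open>M\<close> is a function on the type,
  of which only the restriction to \<open>M\<close> matters.
\<close>

definition bounded_op :: "'a::complex_inner set \<Rightarrow> ('a \<Rightarrow> 'a) \<Rightarrow> bool" where
  "bounded_op M X \<longleftrightarrow>
     (\<forall>x\<in>M. X x \<in> M) \<and>
     (\<forall>x\<in>M. \<forall>y\<in>M. X (x + y) = X x + X y) \<and>
     (\<forall>a. \<forall>x\<in>M. X (a *\<^sub>C x) = a *\<^sub>C X x) \<and>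
     (\<exists>K. \<forall>x\<in>M. norm (X x) \<le> K * norm x)"

text \<open>
  The description is proper for \<open>y \<in> M\<close> whenever \<open>M\<close> is a closed subspace and \<open>X\<close> is a bounded
  operator on \<open>M\<close>, by the Riesz representation theorem.
\<close>

definition adj :: "'a::complex_inner set \<Rightarrow> ('a \<Rightarrow> 'a) \<Rightarrow> 'a \<Rightarrow> 'a" where
  "adj M X y = (THE z. z \<in> M \<and> (\<forall>x\<in>M. cinner (X x) y = cinner x z))"

definition positive_op :: "'a::complex_inner set \<Rightarrow> ('a \<Rightarrow> 'a) \<Rightarrow> bool" where
  "positive_op M X \<longleftrightarrow> (\<forall>x\<in>M. cinner (X x) x \<in> \<real> \<and> 0 \<le> Re (cinner (X x) x))"

definition op_le :: "'a::complex_inner set \<Rightarrow> ('a \<Rightarrow> 'a) \<Rightarrow> ('a \<Rightarrow> 'a) \<Rightarrow> bool" where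
  "op_le M B C \<longleftrightarrow> positive_op M (\<lambda>x. C x - B x)"

definition invertible_op :: "'a::complex_inner set \<Rightarrow> ('a \<Rightarrow> 'a) \<Rightarrow> bool" where
  "invertible_op M X \<longleftrightarrow>
     bounded_op M X \<and> (\<exists>Y. bounded_op M Y \<and> (\<forall>x\<in>M. X (Y x) = x \<and> Y (X x) = x))"

definition left_invertible :: "'a::complex_inner set \<Rightarrow> ('a \<Rightarrow> 'a) \<Rightarrow> bool" where
  "left_invertible M X \<longleftrightarrow> inj_on X M \<and> closed (X ` M)"

definition quasicontraction :: "'a::complex_inner set \<Rightarrow> ('a \<Rightarrow> 'a) \<Rightarrow> bool" where
  "quasicontraction M X \<longleftrightarrow> op_le M ((adj M X ^^ 2) \<circ> (X ^^ 2)) (adj M X \<circ> X)"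

definition quasi_isometry :: "'a::complex_inner set \<Rightarrow> ('a \<Rightarrow> 'a) \<Rightarrow> bool" where
  "quasi_isometry M X \<longleftrightarrow> (\<forall>x\<in>M. ((adj M X ^^ 2) \<circ> (X ^^ 2)) x = (adj M X \<circ> X) x)"


section \<open>Liftings\<close>

text \<open>
  The inclusion of the Hilbert space \<open>'h\<close> as a closed subspace of \<open>M\<close> is rendered by an isometric
  linear embedding \<open>J\<close>; its range is closed because \<open>'h\<close> is complete.
\<close>

definition hilbert_extension ::
    "('h::chilbert_space \<Rightarrow> 'm::chilbert_space) \<Rightarrow> 'm set \<Rightarrow> bool" where
  "hilbert_extension J M \<longleftrightarrow>
     csubspace M \<and> closed M \<and> clinear J \<and>
     (\<forall>h k. cinner (J h) (J k) = cinner h k) \<and> range J \<subseteq> M"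

text \<open>The orthogonal projection of \<open>M\<close> onto \<open>range J\<close>, as a map with values in \<open>'h\<close>.\<close>

definition proj :: "('h::chilbert_space \<Rightarrow> 'm::chilbert_space) \<Rightarrow> 'm \<Rightarrow> 'h" where
  "proj J m = (THE h. \<forall>k. cinner (m - J h) (J k) = 0)"

definition lifting ::
    "('h::chilbert_space \<Rightarrow> 'm::chilbert_space) \<Rightarrow> 'm set \<Rightarrow> ('h \<Rightarrow> 'h) \<Rightarrow> ('m \<Rightarrow> 'm) \<Rightarrow> bool" where
  "lifting J M T Q \<longleftrightarrow>
     hilbert_extension J M \<and> bounded_op M Q \<and> (\<forall>m\<in>M. proj J (Q m) = T (proj J m))"

definition minimal_lifting ::
    "('h::chilbert_space \<Rightarrow> 'm::chilbert_space) \<Rightarrow> 'm set \<Rightarrow> ('h \<Rightarrow> 'h) \<Rightarrow> ('m \<Rightarrow> 'm) \<Rightarrow> bool" where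
  "minimal_lifting J M T Q \<longleftrightarrow>
     lifting J M T Q \<and> M = closure (cspan (\<Union>n. (Q ^^ n) ` range J))"

definition ortho_compl :: "('h::chilbert_space \<Rightarrow> 'm::chilbert_space) \<Rightarrow> 'm set \<Rightarrow> 'm set" where
  "ortho_compl J M = {m \<in> M. \<forall>h. cinner m (J h) = 0}"

definition kernel_op :: "'a::complex_inner set \<Rightarrow> ('a \<Rightarrow> 'a) \<Rightarrow> 'a set" where
  "kernel_op M X = {x \<in> M. X x = 0}"

definition special_lifting ::
    "('h::chilbert_space \<Rightarrow> 'm::chilbert_space) \<Rightarrow> 'm set \<Rightarrow> ('h \<Rightarrow> 'h) \<Rightarrow> ('m \<Rightarrow> 'm) \<Rightarrow> bool" where
  "special_lifting J M T Q \<longleftrightarrow>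
     lifting J M T Q \<and> left_invertible M Q \<and> quasi_isometry M Q \<and>
     ortho_compl J M \<subseteq> kernel_op M (\<lambda>x. (adj M Q \<circ> Q) x - x)"


section \<open>Square-summable sequences in a Hilbert space\<close>

text \<open>
  Types cannot be quantified existentially, so the existence of a space \<open>M \<supset> H\<close> is asserted among
  the closed subspaces of the Hilbert space of square-summable sequences in \<open>H\<close>, while consequences
  of such an existence are asserted for closed subspaces of an arbitrary Hilbert space type.
\<close>

typedef (overloaded) 'a ell2 = "{f :: nat \<Rightarrow> 'a::complex_inner. summable (\<lambda>n. (norm (f n))\<^sup>2)}"
  morphisms ell2_nth Abs_ell2
  by (rule exI[of _ "\<lambda>_. 0"]) simp

lemma ell2_eqI: "(\<And>n. ell2_nth x n = ell2_nth y n) \<Longrightarrow> x = y"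
  by (metis ell2_nth_inject ext)

lemma summable_ell2: "summable (\<lambda>n. (norm (ell2_nth x n))\<^sup>2)"
  using ell2_nth[of x] by simp

lemma norm_add_square_le:
  "(norm (x + y :: 'a::real_normed_vector))\<^sup>2 \<le> 2 * (norm x)\<^sup>2 + 2 * (norm y)\<^sup>2"
proof -
  have "(norm (x + y))\<^sup>2 \<le> (norm x + norm y)\<^sup>2"
    by (rule power_mono[OF norm_triangle_ineq]) simp
  also have "\<dots> \<le> 2 * (norm x)\<^sup>2 + 2 * (norm y)\<^sup>2"
    using sum_squares_bound[of "norm x" "norm y"] by (simp add: power2_sum)
  finally show ?thesis .
qed

lemma summable_ell2_add:
  assumes "summable (\<lambda>n. (norm (f n))\<^sup>2)" "summable (\<lambda>n. (norm (g n))\<^sup>2)"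
  shows "summable (\<lambda>n. (norm (f n + g n :: 'a::real_normed_vector))\<^sup>2)"
  by (rule summable_comparison_test'[where N = 0 and
        g = "\<lambda>n. 2 * (norm (f n))\<^sup>2 + 2 * (norm (g n))\<^sup>2"])
    (use assms in \<open>auto intro!: summable_add summable_mult norm_add_square_le\<close>)

lemma summable_cinner_ell2:
  "summable (\<lambda>n. cinner (ell2_nth x n) (ell2_nth y n))"
proof (rule summable_comparison_test'[where N = 0 and
        g = "\<lambda>n. (norm (ell2_nth x n))\<^sup>2 + (norm (ell2_nth y n))\<^sup>2"])
  show "summable (\<lambda>n. (norm (ell2_nth x n))\<^sup>2 + (norm (ell2_nth y n))\<^sup>2)"
    by (intro summable_add summable_ell2)
next
  fix n
  let ?a = "norm (ell2_nth x n)" and ?b = "norm (ell2_nth y n)"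
  have "norm (cinner (ell2_nth x n) (ell2_nth y n)) \<le> ?a * ?b" by (rule norm_cinner_le)
  also have "\<dots> \<le> ?a\<^sup>2 + ?b\<^sup>2"
    using sum_squares_bound[of ?a ?b] mult_nonneg_nonneg[OF norm_ge_zero norm_ge_zero,
        of "ell2_nth x n" "ell2_nth y n"] by linarith
  finally show "norm (cinner (ell2_nth x n) (ell2_nth y n)) \<le> ?a\<^sup>2 + ?b\<^sup>2" .
qed

instantiation ell2 :: (complex_inner) complex_inner
begin

definition zero_ell2 :: "'a ell2" where "0 = Abs_ell2 (\<lambda>_. 0)"
definition plus_ell2 :: "'a ell2 \<Rightarrow> 'a ell2 \<Rightarrow> 'a ell2" where
  "x + y = Abs_ell2 (\<lambda>n. ell2_nth x n + ell2_nth y n)"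
definition scaleC_ell2 :: "complex \<Rightarrow> 'a ell2 \<Rightarrow> 'a ell2" where
  "a *\<^sub>C x = Abs_ell2 (\<lambda>n. a *\<^sub>C ell2_nth x n)"
definition scaleR_ell2 :: "real \<Rightarrow> 'a ell2 \<Rightarrow> 'a ell2" where
  "r *\<^sub>R (x :: 'a ell2) = complex_of_real r *\<^sub>C x"
definition uminus_ell2 :: "'a ell2 \<Rightarrow> 'a ell2" where "- x = (-1) *\<^sub>R (x :: 'a ell2)"
definition minus_ell2 :: "'a ell2 \<Rightarrow> 'a ell2 \<Rightarrow> 'a ell2" where "x - y = x + - (y :: 'a ell2)"
definition cinner_ell2 :: "'a ell2 \<Rightarrow> 'a ell2 \<Rightarrow> complex" where
  "cinner x y = (\<Sum>n. cinner (ell2_nth x n) (ell2_nth y n))"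
definition inner_ell2 :: "'a ell2 \<Rightarrow> 'a ell2 \<Rightarrow> real" where
  "inner x y = Re (cinner x (y :: 'a ell2))"
definition norm_ell2 :: "'a ell2 \<Rightarrow> real" where "norm x = sqrt (inner x (x :: 'a ell2))"
definition sgn_ell2 :: "'a ell2 \<Rightarrow> 'a ell2" where "sgn x = inverse (norm x) *\<^sub>R (x :: 'a ell2)"
definition dist_ell2 :: "'a ell2 \<Rightarrow> 'a ell2 \<Rightarrow> real" where "dist x y = norm (x - y :: 'a ell2)"
definition uniformity_ell2 :: "('a ell2 \<times> 'a ell2) filter" where
  "uniformity = (INF e\<in>{0<..}. principal {(x, y :: 'a ell2). dist x y < e})"
definition open_ell2 :: "'a ell2 set \<Rightarrow> bool" where
  "open U \<longleftrightarrow> (\<forall>x\<in>U. \<forall>\<^sub>F (x', y :: 'a ell2) in uniformity. x' = x \<longrightarrow> y \<in> U)"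

lemma nth_zero [simp]: "ell2_nth (0 :: 'a ell2) n = 0"
  by (simp add: zero_ell2_def Abs_ell2_inverse)

lemma nth_add [simp]: "ell2_nth (x + y :: 'a ell2) n = ell2_nth x n + ell2_nth y n"
  by (simp add: plus_ell2_def Abs_ell2_inverse summable_ell2_add summable_ell2)

lemma nth_scaleC [simp]: "ell2_nth (a *\<^sub>C x :: 'a ell2) n = a *\<^sub>C ell2_nth x n"
  by (simp add: scaleC_ell2_def Abs_ell2_inverse norm_scaleC power_mult_distrib
      summable_mult summable_ell2)

lemma nth_scaleR [simp]: "ell2_nth (r *\<^sub>R x :: 'a ell2) n = r *\<^sub>R ell2_nth x n"
  by (simp add: scaleR_ell2_def scaleR_scaleC)

lemma nth_uminus [simp]: "ell2_nth (- x :: 'a ell2) n = - ell2_nth x n"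
  by (simp add: uminus_ell2_def)

lemma nth_minus [simp]: "ell2_nth (x - y :: 'a ell2) n = ell2_nth x n - ell2_nth y n"
  by (simp add: minus_ell2_def)

lemma cinner_self_ell2:
  "cinner x (x :: 'a ell2) = complex_of_real (\<Sum>n. (norm (ell2_nth x n))\<^sup>2)"
  unfolding cinner_ell2_def cinner_self by (rule suminf_of_real[OF summable_ell2, symmetric])

instance
proof
  fix x y z :: "'a ell2" and r s :: real and a b :: complex
  show "x + y + z = x + (y + z)" by (rule ell2_eqI) (simp add: add.assoc)
  show "x + y = y + x" by (rule ell2_eqI) (simp add: add.commute)
  show "0 + x = x" by (rule ell2_eqI) simp
  show "- x + x = 0" by (rule ell2_eqI) simp
  show "x - y = x + - y" by (rule minus_ell2_def)
  show "r *\<^sub>R (x + y) = r *\<^sub>R x + r *\<^sub>R y" by (rule ell2_eqI) (simp add: scaleR_add_right)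
  show "(r + s) *\<^sub>R x = r *\<^sub>R x + s *\<^sub>R x" by (rule ell2_eqI) (simp add: scaleR_add_left)
  show "r *\<^sub>R s *\<^sub>R x = (r * s) *\<^sub>R x" by (rule ell2_eqI) simp
  show "1 *\<^sub>R x = x" by (rule ell2_eqI) simp
  show "dist x y = norm (x - y)" by (rule dist_ell2_def)
  show "sgn x = inverse (norm x) *\<^sub>R x" by (rule sgn_ell2_def)
  show "uniformity = (INF e\<in>{0<..}. principal {(x, y :: 'a ell2). dist x y < e})"
    by (rule uniformity_ell2_def)
  show "open U \<longleftrightarrow> (\<forall>x\<in>U. \<forall>\<^sub>F (x', y :: 'a ell2) in uniformity. x' = x \<longrightarrow> y \<in> U)"
    for U :: "'a ell2 set" by (rule open_ell2_def)
  show "norm x = sqrt (inner x x)" by (rule norm_ell2_def)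
  show "a *\<^sub>C (x + y) = a *\<^sub>C x + a *\<^sub>C y" by (rule ell2_eqI) (simp add: scaleC_add_right)
  show "(a + b) *\<^sub>C x = a *\<^sub>C x + b *\<^sub>C x" by (rule ell2_eqI) (simp add: scaleC_add_left)
  show "a *\<^sub>C b *\<^sub>C x = (a * b) *\<^sub>C x" by (rule ell2_eqI) (simp add: scaleC_scaleC)
  show "r *\<^sub>R x = complex_of_real r *\<^sub>C x" by (rule scaleR_ell2_def)
  show inner_Re: "inner x y = Re (cinner x y)" for x y :: "'a ell2" by (rule inner_ell2_def)
  show comm: "cinner x y = cnj (cinner y x)" for x y :: "'a ell2"
  proof -
    have "cnj (cinner y x) = (\<Sum>n. cnj (cinner (ell2_nth y n) (ell2_nth x n)))"
      unfolding cinner_ell2_def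
      by (rule sums_unique[OF iffD2[OF sums_cnj summable_sums[OF summable_cinner_ell2]]])
    then show ?thesis
      by (simp only: cinner_ell2_def cinner_commute[symmetric])
  qed
  show add: "cinner (x + y) z = cinner x z + cinner y z" for x y z :: "'a ell2"
    by (simp add: cinner_ell2_def cinner_add_left suminf_add summable_cinner_ell2)
  show scC: "cinner (a *\<^sub>C x) y = a * cinner x y" for a and x y :: "'a ell2"
    by (simp add: cinner_ell2_def cinner_scaleC_left suminf_mult summable_cinner_ell2)
  show "inner x y = inner y x"
    unfolding inner_Re using comm[of x y] by simp
  show "inner (x + y) z = inner x z + inner y z" by (simp add: inner_Re add)
  show "inner (r *\<^sub>R x) y = r * inner x y" by (simp add: inner_Re scaleR_ell2_def scC)
  show "0 \<le> inner x x"
    by (simp add: inner_Re cinner_self_ell2 suminf_nonneg summable_ell2)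
  show "inner x x = 0 \<longleftrightarrow> x = 0"
    by (auto simp: inner_Re cinner_self_ell2 suminf_eq_zero_iff summable_ell2 intro!: ell2_eqI)
qed

end

lemma norm_ell2_square: "(norm x)\<^sup>2 = (\<Sum>n. (norm (ell2_nth x n))\<^sup>2)"
  by (metis cinner_self cinner_self_ell2 of_real_eq_iff)

lemma sum_le_norm_ell2: "(\<Sum>n<N. (norm (ell2_nth x n))\<^sup>2) \<le> (norm x)\<^sup>2"
  unfolding norm_ell2_square by (rule sum_le_suminf[OF summable_ell2]) auto

lemma norm_nth_le_ell2: "norm (ell2_nth x n) \<le> norm x"
proof -
  have "(norm (ell2_nth x n))\<^sup>2 \<le> (\<Sum>k<Suc n. (norm (ell2_nth x k))\<^sup>2)"
    by (simp add: sum_nonneg)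
  also have "\<dots> \<le> (norm x)\<^sup>2" by (rule sum_le_norm_ell2)
  finally show ?thesis by (rule power2_le_imp_le) simp
qed

instance ell2 :: (chilbert_space) chilbert_space
proof
  fix X :: "nat \<Rightarrow> 'a ell2"
  assume X: "Cauchy X"
  have "Cauchy (\<lambda>i. ell2_nth (X i) n)" for n
  proof (rule CauchyI)
    fix e :: real assume "0 < e"
    with X obtain N where N: "\<forall>i\<ge>N. \<forall>j\<ge>N. norm (X i - X j) < e" by (meson CauchyD)
    show "\<exists>N. \<forall>i\<ge>N. \<forall>j\<ge>N. norm (ell2_nth (X i) n - ell2_nth (X j) n) < e"
      by (metis N le_less_trans norm_nth_le_ell2 nth_minus)
  qed
  then have "\<forall>n. \<exists>l. (\<lambda>i. ell2_nth (X i) n) \<longlonglongrightarrow> l"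
    by (simp add: Cauchy_convergent_iff convergent_def)
  then obtain f where f: "\<And>n. (\<lambda>i. ell2_nth (X i) n) \<longlonglongrightarrow> f n" by metis
  have tail: "\<exists>N. \<forall>i\<ge>N. \<forall>K. (\<Sum>n<K. (norm (ell2_nth (X i) n - f n))\<^sup>2) \<le> e\<^sup>2"
    if e: "0 < e" for e :: real
  proof -
    from CauchyD[OF X e] obtain N where N: "\<forall>i\<ge>N. \<forall>j\<ge>N. norm (X i - X j) < e" by blast
    have "(\<Sum>n<K. (norm (ell2_nth (X i) n - f n))\<^sup>2) \<le> e\<^sup>2" if i: "i \<ge> N" for i K
    proof (rule LIMSEQ_le_const2)
      show "(\<lambda>j. \<Sum>n<K. (norm (ell2_nth (X i) n - ell2_nth (X j) n))\<^sup>2)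
          \<longlonglongrightarrow> (\<Sum>n<K. (norm (ell2_nth (X i) n - f n))\<^sup>2)"
        by (intro tendsto_intros f)
      have "(\<Sum>n<K. (norm (ell2_nth (X i) n - ell2_nth (X j) n))\<^sup>2) \<le> e\<^sup>2" if j: "j \<ge> N" for j
      proof -
        have "(\<Sum>n<K. (norm (ell2_nth (X i - X j) n))\<^sup>2) \<le> (norm (X i - X j))\<^sup>2"
          by (rule sum_le_norm_ell2)
        also have "\<dots> \<le> e\<^sup>2" using N i j by (intro power_mono) (auto intro: less_imp_le)
        finally show ?thesis by simp
      qed
      then show "\<exists>N. \<forall>j\<ge>N. (\<Sum>n<K. (norm (ell2_nth (X i) n - ell2_nth (X j) n))\<^sup>2) \<le> e\<^sup>2"
        by blast
    qed
    then show ?thesis by blast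
  qed
  have summ: "summable (\<lambda>n. (norm (ell2_nth (X i) n - f n))\<^sup>2)"
    if "\<forall>K. (\<Sum>n<K. (norm (ell2_nth (X i) n - f n))\<^sup>2) \<le> e\<^sup>2" for i and e :: real
    by (rule summableI_nonneg_bounded[where x = "e\<^sup>2"]) (use that in auto)
  obtain N where N: "\<forall>i\<ge>N. \<forall>K. (\<Sum>n<K. (norm (ell2_nth (X i) n - f n))\<^sup>2) \<le> 1\<^sup>2"
    using tail[of 1] by auto
  have "summable (\<lambda>n. (norm (f n - ell2_nth (X N) n))\<^sup>2)"
    using summ[of N 1] N by (simp add: norm_minus_commute)
  from summable_ell2_add[OF this summable_ell2[of "X N"]]
  have "summable (\<lambda>n. (norm (f n))\<^sup>2)" by simp
  then have L: "ell2_nth (Abs_ell2 f) = f" by (simp add: Abs_ell2_inverse)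
  have "X \<longlonglongrightarrow> Abs_ell2 f"
  proof (rule LIMSEQ_I)
    fix r :: real assume r: "0 < r"
    obtain N where N: "\<forall>i\<ge>N. \<forall>K. (\<Sum>n<K. (norm (ell2_nth (X i) n - f n))\<^sup>2) \<le> (r/2)\<^sup>2"
      using tail[of "r/2"] r by auto
    have "norm (X i - Abs_ell2 f) < r" if i: "i \<ge> N" for i
    proof -
      have "(norm (X i - Abs_ell2 f))\<^sup>2 = (\<Sum>n. (norm (ell2_nth (X i) n - f n))\<^sup>2)"
        by (simp add: norm_ell2_square L)
      also have "\<dots> \<le> (r/2)\<^sup>2"
        using N i by (intro suminf_le_const summ[where e = "r/2"]) auto
      finally have "norm (X i - Abs_ell2 f) \<le> r/2"
        by (rule power2_le_imp_le) (use r in simp)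
      then show ?thesis using r by simp
    qed
    then show "\<exists>N. \<forall>i\<ge>N. norm (X i - Abs_ell2 f) < r" by blast
  qed
  then show "convergent X" by (rule convergentI)
qed

end

theory Submission
  imports Defs
begin

text \<open>
  Everything is read off from quadratic forms. That \<open>T\<close> is a quasicontraction means
  \<open>\<parallel>T (T x)\<parallel> \<le> \<parallel>T x\<parallel>\<close>: the operator \<open>T\<close> is a contraction on its range. Let \<open>P\<close> be the projection onto
  the closure of the range and \<open>R = T P\<close>. Then \<open>R\<close> is a contraction on the whole space which still
  satisfies \<open>R T = T T\<close>, and the form
    \<open>a x = \<parallel>x\<parallel>\<^sup>2 + \<parallel>T x\<parallel>\<^sup>2 - \<parallel>R x\<parallel>\<^sup>2\<close>
  dominates \<open>\<parallel>T x\<parallel>\<^sup>2\<close>, equals \<open>\<parallel>x\<parallel>\<^sup>2\<close> on the range of \<open>T\<close>, and is coercive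
  (\<open>quasicontraction_range_contraction\<close>). Both constructions rest on this form.

  For the operator inequality, the operator \<open>A = I + T\<^sup>* T - R\<^sup>* R\<close> of the form \<open>a\<close> is invertible
  by coercivity, and the identity \<open>R T = T T\<close> gives \<open>T\<^sup>* A T = T\<^sup>* T \<le> A\<close>. Conversely, testing
  \<open>T\<^sup>* T \<le> A\<close> at \<open>T h\<close> gives \<open>\<parallel>T (T h)\<parallel>\<^sup>2 \<le> \<langle>A T h, T h\<rangle> = \<parallel>T h\<parallel>\<^sup>2\<close>.

  For the lifting, an operator \<open>Q\<close> on a space of sequences is needed whose first coordinate acts as
  \<open>T\<close> and with \<open>\<parallel>Q x\<parallel>\<^sup>2 = \<parallel>x\<parallel>\<^sup>2 + \<parallel>T x\<^sub>0\<parallel>\<^sup>2 - \<parallel>R x\<^sub>0\<parallel>\<^sup>2\<close>. By polarization such a \<open>Q\<close> has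
  \<open>Q\<^sup>* Q = I\<close> on the sequences with \<open>x\<^sub>0 = 0\<close>; it is quasi-isometric because \<open>R T = T T\<close>, and
  bounded below because \<open>a\<close> is coercive. What has to be produced is an operator \<open>D\<close> into the
  sequences with \<open>D\<^sup>* D = I - R\<^sup>* R\<close>. Instead of a square root, \<open>D\<close> uses the expansion
    \<open>1 - s = \<Sum>k. s\<^sup>k (1 - s)\<^sup>2\<close>  for \<open>0 \<le> s \<le> 1\<close>
  with \<open>s = R\<^sup>* R\<close>, in which \<open>s\<^sup>k = W\<^sup>* W\<close> for the alternating product \<open>W\<close> of \<open>k\<close> factors \<open>R\<close>
  and \<open>R\<^sup>*\<close> (\<open>alternating_power_defect_sums\<close>). Restricting \<open>Q\<close> to the closed span of the orbit of
  the first coordinate space makes the lifting minimal. Conversely, any lifting of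
  this kind preserves the orthogonality of the embedded space and its complement, and comparing \<open>\<parallel>Q Q J h\<parallel>\<close> with
  \<open>\<parallel>Q J h\<parallel>\<close> leaves \<open>\<parallel>Q J T h\<parallel> = \<parallel>T h\<parallel>\<close>, so that projecting gives \<open>\<parallel>T (T h)\<parallel> \<le> \<parallel>T h\<parallel>\<close>.
\<close>

section \<open>Inner products and bounded operators\<close>

interpretation cvs: vector_space "scaleC :: complex \<Rightarrow> 'a::complex_inner \<Rightarrow> 'a"
  by (rule vector_space_scaleC)

lemma cinner_zero_left [simp]: "cinner 0 (x :: 'a::complex_inner) = 0"
  using cinner_add_left[of 0 0 x] by simp

lemma cinner_zero_right [simp]: "cinner (x :: 'a::complex_inner) 0 = 0"
  using cinner_add_right[of x 0 0] by simp

lemma cinner_diff_left: "cinner (x - y) z = cinner x z - cinner y (z :: 'a::complex_inner)"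
  using cinner_add_left[of "x - y" y z] by simp

lemma cinner_diff_right: "cinner z (x - y) = cinner z x - cinner z (y :: 'a::complex_inner)"
  using cinner_add_right[of z "x - y" y] by simp

lemmas cinner_simps = cinner_add_left cinner_add_right cinner_diff_left cinner_diff_right
  cinner_scaleC_left cinner_scaleC_right

lemma cinner_eq_zero_iff [simp]: "cinner x x = 0 \<longleftrightarrow> x = (0 :: 'a::complex_inner)"
  by (simp add: cinner_self)

lemma Re_cinner_self: "Re (cinner x x) = (norm (x :: 'a::complex_inner))\<^sup>2"
  by (simp add: cinner_self)

lemma cinner_ext_on:
  fixes u v :: "'a::complex_inner"
  assumes "csubspace M" "u \<in> M" "v \<in> M" "\<And>x. x \<in> M \<Longrightarrow> cinner x u = cinner x v"
  shows "u = v"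
proof -
  have "cinner (u - v) (u - v) = 0"
    using assms cvs.subspace_diff[OF assms(1-3)] by (simp add: cinner_diff_right)
  then show ?thesis by simp
qed

lemma tendsto_cinner_right:
  fixes y :: "'a::complex_inner"
  assumes "z \<longlonglongrightarrow> l"
  shows "(\<lambda>n. cinner y (z n)) \<longlonglongrightarrow> cinner y l"
proof (rule LIM_zero_cancel, rule Lim_null_comparison)
  show "\<forall>\<^sub>F n in sequentially. norm (cinner y (z n) - cinner y l) \<le> norm y * norm (z n - l)"
    using norm_cinner_le[of y] by (simp add: cinner_diff_right[symmetric])
  show "(\<lambda>n. norm y * norm (z n - l)) \<longlonglongrightarrow> 0"
    using tendsto_mult_right_zero[OF tendsto_norm_zero[OF LIM_zero[OF assms]]] .
qed

lemma closure_csubspace: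
  fixes M :: "'a::complex_inner set"
  assumes M: "csubspace M"
  shows "csubspace (closure M)"
proof (rule cvs.subspaceI)
  show "0 \<in> closure M" using cvs.subspace_0[OF M] closure_subset by blast
  show "x + y \<in> closure M" if x: "x \<in> closure M" and y: "y \<in> closure M" for x y
  proof -
    obtain f g where "\<And>n. f n \<in> M" "f \<longlonglongrightarrow> x" "\<And>n. g n \<in> M" "g \<longlonglongrightarrow> y"
      using x y unfolding closure_sequential by blast
    then show ?thesis
      unfolding closure_sequential
      by (intro exI[of _ "\<lambda>n. f n + g n"]) (auto intro!: tendsto_add cvs.subspace_add[OF M])
  qed
  show "a *\<^sub>C x \<in> closure M" if x: "x \<in> closure M" for a x
  proof -
    obtain f where f: "\<And>n. f n \<in> M" "f \<longlonglongrightarrow> x"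
      using x unfolding closure_sequential by blast
    have "bounded_linear (\<lambda>x :: 'a. a *\<^sub>C x)"
      by (rule bounded_linear_intro[where K = "cmod a"])
        (auto simp: scaleC_add_right scaleR_scaleC scaleC_scaleC mult.commute norm_scaleC)
    from bounded_linear.tendsto[OF this f(2)] show ?thesis
      unfolding closure_sequential
      by (intro exI[of _ "\<lambda>n. a *\<^sub>C f n"]) (auto intro!: cvs.subspace_scale[OF M] f)
  qed
qed

lemma bounded_opD:
  assumes "bounded_op M X"
  shows bounded_op_mem: "x \<in> M \<Longrightarrow> X x \<in> M"
    and bounded_op_add: "x \<in> M \<Longrightarrow> y \<in> M \<Longrightarrow> X (x + y) = X x + X y"
    and bounded_op_scale: "x \<in> M \<Longrightarrow> X (a *\<^sub>C x) = a *\<^sub>C X x"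
  using assms unfolding bounded_op_def by auto

lemma bounded_op_bound:
  assumes "bounded_op M X"
  obtains K where "K \<ge> 0" "\<And>x. x \<in> M \<Longrightarrow> norm (X x) \<le> K * norm x"
proof -
  obtain K where K: "\<forall>x\<in>M. norm (X x) \<le> K * norm x"
    using assms unfolding bounded_op_def by blast
  have "norm (X x) \<le> max K 0 * norm x" if "x \<in> M" for x
    using bspec[OF K that] mult_right_mono[of K "max K 0" "norm x"] by simp
  then show ?thesis using that[of "max K 0"] by simp
qed

lemma bounded_op_diff:
  assumes "bounded_op M X" "csubspace M" "x \<in> M" "y \<in> M"
  shows "X (x - y) = X x - X y"
  using bounded_op_add[OF assms(1) cvs.subspace_diff[OF assms(2-4)] assms(4)]
  by (simp add: algebra_simps)

lemma bounded_op_subset: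
  assumes "bounded_op UNIV X" "X ` M \<subseteq> M"
  shows "bounded_op M X"
  using assms unfolding bounded_op_def by (auto simp: image_subset_iff)

lemma bounded_linear_if_bounded_op:
  assumes X: "bounded_op UNIV X"
  shows "bounded_linear X"
proof -
  obtain K where "\<And>x. norm (X x) \<le> K * norm x" using bounded_op_bound[OF X] by auto
  then show ?thesis
    by (intro bounded_linear_intro[where K = K])
      (simp_all add: bounded_op_add[OF X] bounded_op_scale[OF X] scaleR_scaleC mult.commute)
qed

lemma bounded_op_compose:
  assumes X: "bounded_op M X" and Y: "bounded_op M Y"
  shows "bounded_op M (\<lambda>x. X (Y x))"
proof -
  obtain K L where K: "K \<ge> 0" "\<And>x. x \<in> M \<Longrightarrow> norm (X x) \<le> K * norm x"
    and L: "\<And>x. x \<in> M \<Longrightarrow> norm (Y x) \<le> L * norm x"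
    using bounded_op_bound[OF X] bounded_op_bound[OF Y] by metis
  have "norm (X (Y x)) \<le> (K * L) * norm x" if "x \<in> M" for x
    using order_trans[OF K(2)[OF bounded_op_mem[OF Y that]] mult_left_mono[OF L[OF that] K(1)]]
    by (simp add: mult.assoc)
  then show ?thesis
    using X Y unfolding bounded_op_def by auto
qed

text \<open>
  Over the complex numbers the diagonal determines a sesquilinear form: the values at \<open>x + y\<close> and
  \<open>\<i> x + y\<close> give the sum and the difference of \<open>B x y\<close> and \<open>B y x\<close>. This turns every identity
  between norms below into an identity between operators.
\<close>

lemma cinner_polarization:
  fixes B :: "'a::complex_inner \<Rightarrow> 'a \<Rightarrow> complex"
  assumes M: "csubspace M"
    and add: "\<And>x y z. x \<in> M \<Longrightarrow> y \<in> M \<Longrightarrow> z \<in> M \<Longrightarrow> B (x + y) z = B x z + B y z"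
      "\<And>x y z. x \<in> M \<Longrightarrow> y \<in> M \<Longrightarrow> z \<in> M \<Longrightarrow> B z (x + y) = B z x + B z y"
    and scale: "\<And>a x y. x \<in> M \<Longrightarrow> y \<in> M \<Longrightarrow> B (a *\<^sub>C x) y = a * B x y"
      "\<And>a x y. x \<in> M \<Longrightarrow> y \<in> M \<Longrightarrow> B x (a *\<^sub>C y) = cnj a * B x y"
    and diag: "\<And>x. x \<in> M \<Longrightarrow> B x x = 0"
    and x: "x \<in> M" and y: "y \<in> M"
  shows "B x y = 0"
proof -
  note mem = cvs.subspace_add[OF M] cvs.subspace_scale[OF M]
  have "B (x + y) (x + y) = B x x + B x y + (B y x + B y y)"
    using x y by (simp add: mem add)
  then have "B x y + B y x = 0"
    using x y by (simp add: mem diag)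
  moreover have "B (\<i> *\<^sub>C x + y) (\<i> *\<^sub>C x + y) = B x x + \<i> * B x y + (- \<i> * B y x + B y y)"
    using x y by (simp add: mem add scale algebra_simps)
  then have "\<i> * B x y - \<i> * B y x = 0"
    using x y by (simp add: mem diag)
  ultimately show ?thesis by (simp add: right_diff_distrib[symmetric])
qed

section \<open>Representation of functionals\<close>

text \<open>
  The minimizer of \<open>\<langle>S z, z\<rangle> - 2 Re (f z)\<close> over \<open>M\<close> represents \<open>f\<close>: coercivity makes a minimizing
  sequence Cauchy, by the parallelogram identity for the form of \<open>S\<close>, and the first variation at the
  limit vanishes. The case \<open>S = I\<close> is the Riesz theorem, and \<open>f = \<langle>\<cdot>, y\<rangle>\<close> is solvability of
  \<open>S z = y\<close>; both are used.
\<close>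

theorem coercive_representation:
  fixes M :: "'a::chilbert_space set"
  assumes M: "csubspace M" "closed M" and S: "bounded_op M S"
    and sym: "\<And>x y. x \<in> M \<Longrightarrow> y \<in> M \<Longrightarrow> cinner (S x) y = cinner x (S y)"
    and d: "0 < d" and coercive: "\<And>x. x \<in> M \<Longrightarrow> d * (norm x)\<^sup>2 \<le> Re (cinner (S x) x)"
    and f_add: "\<And>x y. x \<in> M \<Longrightarrow> y \<in> M \<Longrightarrow> f (x + y) = f x + f y"
    and f_scale: "\<And>a x. x \<in> M \<Longrightarrow> f (a *\<^sub>C x) = a * f x"
    and f_bound: "\<And>x. x \<in> M \<Longrightarrow> cmod (f x) \<le> K * norm x"
  shows "\<exists>z\<in>M. \<forall>x\<in>M. f x = cinner x (S z)"
proof -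
  note mem = cvs.subspace_add[OF M(1)] cvs.subspace_scale[OF M(1)] cvs.subspace_diff[OF M(1)]
  define \<phi> where "\<phi> z = Re (cinner (S z) z) - 2 * Re (f z)" for z
  define I where "I = Inf (\<phi> ` M)"
  have "- (K\<^sup>2 / d) \<le> \<phi> z" if "z \<in> M" for z
  proof -
    have "0 \<le> (d * norm z - K)\<^sup>2 / d" using d by simp
    also have "\<dots> = d * (norm z)\<^sup>2 - 2 * (K * norm z) + K\<^sup>2 / d"
      using d by (simp add: power2_eq_square field_simps)
    also have "\<dots> \<le> Re (cinner (S z) z) - 2 * Re (f z) + K\<^sup>2 / d"
      using coercive[OF that] f_bound[OF that] complex_Re_le_cmod[of "f z"] by linarith
    finally show ?thesis by (simp add: \<phi>_def)
  qed
  then have bdd: "bdd_below (\<phi> ` M)" by (auto intro!: bdd_belowI)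
  have I_le: "I \<le> \<phi> z" if "z \<in> M" for z
    unfolding I_def using that by (intro cInf_lower bdd) auto
  have "\<exists>z\<in>M. \<phi> z < I + 1 / real (Suc n)" for n
  proof -
    have "\<phi> ` M \<noteq> {}" using cvs.subspace_0[OF M(1)] by blast
    then show ?thesis
      using cInf_lessD[of "\<phi> ` M" "I + 1 / real (Suc n)"] unfolding I_def by auto
  qed
  then obtain z where z: "\<And>n. z n \<in> M" "\<And>n. \<phi> (z n) < I + 1 / real (Suc n)" by metis
  have midpoint: "d / 2 * (norm (a - b))\<^sup>2 \<le> \<phi> a + \<phi> b - 2 * I" if ab: "a \<in> M" "b \<in> M" for a b
  proof -
    define m where "m = (1/2) *\<^sub>C (a + b)"
    have Sm: "S m = (1/2) *\<^sub>C (S a + S b)" and fm: "f m = (1/2) * (f a + f b)" and mM: "m \<in> M"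
      unfolding m_def using ab S
      by (simp_all add: mem bounded_op_add bounded_op_scale f_add f_scale)
    have "\<phi> a + \<phi> b - 2 * \<phi> m = 1/2 * Re (cinner (S (a - b)) (a - b))"
      unfolding \<phi>_def fm Sm bounded_op_diff[OF S M(1) ab] unfolding m_def
      by (simp add: cinner_simps algebra_simps)
    then show ?thesis using I_le[OF mM] coercive[of "a - b"] ab by (simp add: mem)
  qed
  have "Cauchy z"
  proof (rule CauchyI)
    fix e :: real assume e: "0 < e"
    obtain N where N: "2 / (d / 2 * e\<^sup>2) < real N" using reals_Archimedean2 by blast
    have "norm (z m - z n) < e" if mn: "m \<ge> N" "n \<ge> N" for m n
    proof -
      have "0 < 2 / (d / 2 * e\<^sup>2)" using d e by simp
      with N have N0: "0 < real N" by linarith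
      have "d / 2 * (norm (z m - z n))\<^sup>2 \<le> 1 / real (Suc m) + 1 / real (Suc n)"
        using midpoint[OF z(1) z(1), of m n] z(2)[of m] z(2)[of n] by linarith
      also have "\<dots> \<le> 1 / real N + 1 / real N"
        using mn N0 by (intro add_mono divide_left_mono) auto
      also have "\<dots> < d / 2 * e\<^sup>2" using N N0 d e by (simp add: field_simps)
      finally have "(norm (z m - z n))\<^sup>2 < e\<^sup>2" using d by simp
      then show ?thesis using e by (simp add: power_less_imp_less_base)
    qed
    then show "\<exists>N. \<forall>m\<ge>N. \<forall>n\<ge>N. norm (z m - z n) < e" by blast
  qed
  then obtain l where l: "z \<longlonglongrightarrow> l" using Cauchy_convergent_iff convergent_def by blast
  have lM: "l \<in> M" using closed_sequentially[OF M(2)] z(1) l by blast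
  have Re_eq: "Re (f x) = Re (cinner x (S l))" if x: "x \<in> M" for x
  proof -
    define q c where "q = Re (cinner (S x) x)" and "c = Re (cinner (S x) l) - Re (f x)"
    have q: "q \<ge> 0"
      unfolding q_def using coercive[OF x] d by (smt (verit) mult_nonneg_nonneg zero_le_power2)
    \<comment> \<open>Near-minimality of \<open>z n\<close> bounds the increment of \<open>\<phi>\<close> in direction \<open>x\<close>; the bound passes to the limit.\<close>
    have var: "0 \<le> 2 * t * c + t\<^sup>2 * q" for t :: real
    proof (rule LIMSEQ_le)
      let ?c = "\<lambda>n. Re (cinner (S x) (z n)) - Re (f x)"
      show "(\<lambda>n. - (1 / real (Suc n))) \<longlonglongrightarrow> 0"
        using tendsto_minus[OF LIMSEQ_inverse_real_of_nat] by (simp add: inverse_eq_divide)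
      show "(\<lambda>n. 2 * t * ?c n + t\<^sup>2 * q) \<longlonglongrightarrow> 2 * t * c + t\<^sup>2 * q"
        unfolding c_def by (intro tendsto_intros tendsto_cinner_right l)
      have "- (1 / real (Suc n)) \<le> 2 * t * ?c n + t\<^sup>2 * q" for n
      proof -
        define y where "y = complex_of_real t *\<^sub>C x"
        have y: "y \<in> M" and Sy: "S y = complex_of_real t *\<^sub>C S x" and fy: "f y = t * f x"
          unfolding y_def using x S by (simp_all add: mem bounded_op_scale f_scale)
        have "Re (cinner (S (z n)) x) = Re (cinner (S x) (z n))"
          using sym[OF z(1) x] cinner_commute[of "z n" "S x"] by simp
        then have "\<phi> (z n + y) - \<phi> (z n) = 2 * t * ?c n + t\<^sup>2 * q"
          unfolding \<phi>_def bounded_op_add[OF S z(1) y] f_add[OF z(1) y] Sy fy q_def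
          by (simp add: y_def cinner_simps algebra_simps power2_eq_square)
        then show ?thesis using I_le[of "z n + y"] z[of n] y by (simp add: mem)
      qed
      then show "\<exists>N. \<forall>n\<ge>N. - (1 / real (Suc n)) \<le> 2 * t * ?c n + t\<^sup>2 * q" by blast
    qed
    \<comment> \<open>A quadratic without constant term is nonnegative only if its linear coefficient vanishes;
      the denominator \<open>q + 1\<close> covers the case \<open>q = 0\<close>.\<close>
    have "2 * (- c / (q + 1)) * c + (- c / (q + 1))\<^sup>2 * q = - (c\<^sup>2 * (q + 2) / (q + 1)\<^sup>2)"
      using q by (simp add: power2_eq_square divide_simps) (simp add: algebra_simps)
    with var[of "- c / (q + 1)"] have "c\<^sup>2 * (q + 2) / (q + 1)\<^sup>2 \<le> 0" by simp
    then have "c = 0" using q by (auto simp: divide_le_0_iff mult_le_0_iff)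
    then show ?thesis unfolding c_def using sym[OF x lM] by simp
  qed
  \<comment> \<open>The imaginary parts are the real parts at \<open>\<i> x\<close>.\<close>
  have "f x = cinner x (S l)" if x: "x \<in> M" for x
    using Re_eq[OF x] Re_eq[OF mem(2)[OF x, of \<i>]] f_scale[OF x, of \<i>]
    by (simp add: complex_eq_iff cinner_scaleC_left)
  then show ?thesis using lM by blast
qed

lemma bounded_op_ident: "bounded_op M (\<lambda>x. x)"
  unfolding bounded_op_def by (auto intro: exI[of _ 1])

corollary riesz_representation:
  fixes M :: "'a::chilbert_space set"
  assumes M: "csubspace M" "closed M"
    and f: "\<And>x y. x \<in> M \<Longrightarrow> y \<in> M \<Longrightarrow> f (x + y) = f x + f y"
      "\<And>a x. x \<in> M \<Longrightarrow> f (a *\<^sub>C x) = a * f x"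
      "\<And>x. x \<in> M \<Longrightarrow> cmod (f x) \<le> K * norm x"
  shows "\<exists>z\<in>M. \<forall>x\<in>M. f x = cinner x z"
  by (rule coercive_representation[OF M bounded_op_ident, where d = 1 and f = f and K = K])
    (use f in \<open>auto simp: Re_cinner_self\<close>)

lemma ex_orthogonal_projection:
  fixes M :: "'a::chilbert_space set"
  assumes M: "csubspace M" "closed M"
  shows "\<exists>p\<in>M. \<forall>m\<in>M. cinner m p = cinner m y"
proof -
  have "\<exists>p\<in>M. \<forall>m\<in>M. cinner m y = cinner m p"
    by (rule riesz_representation[OF M, where K = "norm y"])
      (auto simp: cinner_simps mult.commute intro: order_trans[OF norm_cinner_le])
  then show ?thesis by auto
qed

lemma coercive_invertible:
  fixes A :: "'a::chilbert_space \<Rightarrow> 'a"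
  assumes A: "bounded_op UNIV A"
    and sym: "\<And>x y. cinner (A x) y = cinner x (A y)"
    and d: "0 < d" and coercive: "\<And>x. d * (norm x)\<^sup>2 \<le> Re (cinner (A x) x)"
  shows "invertible_op UNIV A"
proof -
  have "\<exists>z. A z = y" for y
  proof -
    have "\<exists>z\<in>UNIV. \<forall>x\<in>UNIV. cinner x y = cinner x (A z)"
      by (rule coercive_representation[OF cvs.subspace_UNIV closed_UNIV A sym d coercive,
            where K = "norm y"])
        (auto simp: cinner_simps mult.commute intro: order_trans[OF norm_cinner_le])
    then show ?thesis using cinner_ext_on[OF cvs.subspace_UNIV UNIV_I UNIV_I] by metis
  qed
  then obtain Y where AY: "\<And>y. A (Y y) = y" by metis
  have bound: "d * norm x \<le> norm (A x)" for x
  proof (cases "x = 0")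
    case False
    have "d * norm x * norm x \<le> Re (cinner (A x) x)"
      using coercive[of x] by (simp add: power2_eq_square)
    also have "\<dots> \<le> norm (A x) * norm x"
      by (rule order_trans[OF complex_Re_le_cmod norm_cinner_le])
    finally show ?thesis using False by simp
  qed simp
  have inj: "x = y" if "A x = A y" for x y
    using bound[of "x - y"] bounded_op_diff[OF A cvs.subspace_UNIV, of x y] that d
    by (simp add: mult_le_0_iff)
  have "bounded_op UNIV Y"
    unfolding bounded_op_def
  proof (intro conjI ballI allI exI[of _ "1/d"] UNIV_I)
    show "Y (x + y) = Y x + Y y" for x y by (rule inj) (simp add: AY bounded_op_add[OF A])
    show "Y (a *\<^sub>C x) = a *\<^sub>C Y x" for a x by (rule inj) (simp add: AY bounded_op_scale[OF A])
    show "norm (Y x) \<le> 1 / d * norm x" for x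
      using bound[of "Y x"] d by (simp add: AY field_simps)
  qed
  then show ?thesis
    unfolding invertible_op_def using A AY inj by blast
qed

section \<open>Adjoints, quasicontractions and quasi-isometries\<close>

lemma adj_unique:
  fixes M :: "'a::chilbert_space set"
  assumes "csubspace M" "z \<in> M" "\<And>x. x \<in> M \<Longrightarrow> cinner (X x) y = cinner x z"
  shows "adj M X y = z"
  unfolding adj_def
proof (rule the_equality)
  fix z' assume "z' \<in> M \<and> (\<forall>x\<in>M. cinner (X x) y = cinner x z')"
  then show "z' = z" using assms by (intro cinner_ext_on[OF assms(1)]) auto
qed (use assms in auto)

lemma adj_props:
  fixes M :: "'a::chilbert_space set"
  assumes M: "csubspace M" "closed M" and X: "bounded_op M X"
  shows adj_mem: "adj M X y \<in> M"
    and cinner_adj: "x \<in> M \<Longrightarrow> cinner x (adj M X y) = cinner (X x) y"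
proof -
  obtain K where K: "\<And>x. x \<in> M \<Longrightarrow> norm (X x) \<le> K * norm x" using bounded_op_bound[OF X] by blast
  have "\<exists>z\<in>M. \<forall>x\<in>M. cinner (X x) y = cinner x z"
  proof (rule riesz_representation[OF M, where K = "K * norm y"])
    show "cmod (cinner (X x) y) \<le> K * norm y * norm x" if "x \<in> M" for x
      using order_trans[OF norm_cinner_le mult_right_mono[OF K[OF that] norm_ge_zero[of y]]]
      by (simp add: ac_simps)
  qed (simp_all add: bounded_op_add[OF X] bounded_op_scale[OF X] cinner_simps)
  then obtain z where z: "z \<in> M" "\<And>x. x \<in> M \<Longrightarrow> cinner (X x) y = cinner x z" by blast
  then show "adj M X y \<in> M" "x \<in> M \<Longrightarrow> cinner x (adj M X y) = cinner (X x) y"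
    using adj_unique[OF M(1) z] by auto
qed

lemma cinner_adj_left:
  fixes M :: "'a::chilbert_space set"
  assumes "csubspace M" "closed M" "bounded_op M X" "x \<in> M"
  shows "cinner (adj M X y) x = cinner y (X x)"
  using cinner_adj[OF assms, of y] by (metis cinner_commute)

lemma norm_adj_le:
  fixes M :: "'a::chilbert_space set"
  assumes M: "csubspace M" "closed M" and X: "bounded_op M X"
    and K: "0 \<le> K" "\<And>x. x \<in> M \<Longrightarrow> norm (X x) \<le> K * norm x"
  shows "norm (adj M X y) \<le> K * norm y"
proof (cases "adj M X y = 0")
  case False
  define w where "w = adj M X y"
  have w: "w \<in> M" unfolding w_def by (rule adj_mem[OF M X])
  have "norm w * norm w = Re (cinner w w)" by (simp only: Re_cinner_self power2_eq_square)
  also have "\<dots> = Re (cinner (X w) y)"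
    using cinner_adj[OF M X w, of y] by (simp add: w_def[symmetric])
  also have "\<dots> \<le> norm (X w) * norm y"
    by (rule order_trans[OF complex_Re_le_cmod norm_cinner_le])
  also have "\<dots> \<le> K * norm w * norm y"
    by (rule mult_right_mono[OF K(2)[OF w] norm_ge_zero])
  finally have "norm w * norm w \<le> (K * norm y) * norm w" by (simp add: ac_simps)
  then show ?thesis using False by (simp add: w_def)
qed (use K in simp)

lemma bounded_op_adj:
  fixes M :: "'a::chilbert_space set"
  assumes M: "csubspace M" "closed M" and X: "bounded_op M X"
  shows "bounded_op M (adj M X)"
proof -
  note mem = adj_mem[OF M X]
  obtain K where "K \<ge> 0" "\<And>x. x \<in> M \<Longrightarrow> norm (X x) \<le> K * norm x"
    using bounded_op_bound[OF X] by blast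
  from norm_adj_le[OF M X this] have "\<exists>K. \<forall>y\<in>M. norm (adj M X y) \<le> K * norm y" by blast
  moreover have "adj M X (y + z) = adj M X y + adj M X z" for y z
    by (rule adj_unique[OF M(1)])
      (simp_all add: cvs.subspace_add[OF M(1)] mem cinner_add_right cinner_adj[OF M X])
  moreover have "adj M X (a *\<^sub>C y) = a *\<^sub>C adj M X y" for a y
    by (rule adj_unique[OF M(1)])
      (simp_all add: cvs.subspace_scale[OF M(1)] mem cinner_scaleC_right cinner_adj[OF M X])
  ultimately show ?thesis unfolding bounded_op_def by (simp add: mem)
qed

text \<open>
  The form of \<open>T\<^sup>* T - T\<^sup>*\<^sup>2 T\<^sup>2\<close> at \<open>x\<close> is \<open>\<parallel>T x\<parallel>\<^sup>2 - \<parallel>T (T x)\<parallel>\<^sup>2\<close>.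
\<close>

lemma quasicontraction_iff:
  fixes T :: "'a::chilbert_space \<Rightarrow> 'a"
  assumes T: "bounded_op UNIV T"
  shows "quasicontraction UNIV T \<longleftrightarrow> (\<forall>x. norm (T (T x)) \<le> norm (T x))"
proof -
  note adj = cinner_adj_left[OF cvs.subspace_UNIV closed_UNIV T UNIV_I]
  have "cinner ((adj UNIV T \<circ> T) x - ((adj UNIV T ^^ 2) \<circ> (T ^^ 2)) x) x =
      complex_of_real ((norm (T x))\<^sup>2 - (norm (T (T x)))\<^sup>2)" for x
    by (simp add: numeral_2_eq_2 cinner_diff_left adj cinner_self[unfolded numeral_2_eq_2])
  then show ?thesis
    unfolding quasicontraction_def op_le_def positive_op_def by (simp add: power2_le_iff_abs_le)
qed

lemma quasi_isometry_iff:
  fixes M :: "'a::chilbert_space set"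
  assumes M: "csubspace M" "closed M" and Q: "bounded_op M Q"
  shows "quasi_isometry M Q \<longleftrightarrow> (\<forall>x\<in>M. norm (Q (Q x)) = norm (Q x))"
proof
  note adj = cinner_adj[OF M Q] and mem = bounded_op_mem[OF Q]
  {
    assume "quasi_isometry M Q"
    then have eq: "adj M Q (adj M Q (Q (Q x))) = adj M Q (Q x)" if "x \<in> M" for x
      using that unfolding quasi_isometry_def by (simp add: numeral_2_eq_2)
    show "\<forall>x\<in>M. norm (Q (Q x)) = norm (Q x)"
    proof
      fix x assume x: "x \<in> M"
      have "cinner (Q (Q x)) (Q (Q x)) = cinner (Q x) (Q x)"
        using arg_cong[OF eq[OF x], of "cinner x"] x by (simp add: adj mem)
      then show "norm (Q (Q x)) = norm (Q x)"
        by (simp add: cinner_self del: of_real_power)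
    qed
  next
    assume iso: "\<forall>x\<in>M. norm (Q (Q x)) = norm (Q x)"
    have "cinner (Q (Q x)) (Q (Q y)) - cinner (Q x) (Q y) = 0" if "x \<in> M" "y \<in> M" for x y
      by (rule cinner_polarization[OF M(1) _ _ _ _ _ that])
        (simp_all add: iso mem bounded_op_add[OF Q] bounded_op_scale[OF Q] cinner_simps
          cinner_self algebra_simps)
    then show "quasi_isometry M Q"
      unfolding quasi_isometry_def
      by (auto simp: numeral_2_eq_2 adj mem adj_mem[OF M Q] intro!: adj_unique[OF M(1)])
  }
qed

section \<open>Quasicontractions from liftings\<close>

lemma hilbert_extension_isometry:
  assumes "hilbert_extension J M"
  shows "J (x + y) = J x + J y" "J (a *\<^sub>C x) = a *\<^sub>C J x" "J (x - y) = J x - J y"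
    "J x \<in> M" "csubspace M" "closed M" "cinner (J x) (J y) = cinner x y"
    "norm (J x) = norm x"
proof -
  have "clinear J" and iso: "\<And>x y. cinner (J x) (J y) = cinner x y"
    using assms unfolding hilbert_extension_def by auto
  then have J: "module_hom scaleC scaleC J" by (simp add: linear_iff_module_hom)
  show "J (x + y) = J x + J y" "J (a *\<^sub>C x) = a *\<^sub>C J x" "J (x - y) = J x - J y"
    using module_hom.add[OF J] module_hom.scale[OF J] module_hom.diff[OF J] by auto
  show "J x \<in> M" "csubspace M" "closed M" "cinner (J x) (J y) = cinner x y"
    using assms unfolding hilbert_extension_def by auto
  have "(norm (J x))\<^sup>2 = (norm x)\<^sup>2" using iso[of x x] by (simp add: Re_cinner_self[symmetric])
  then show "norm (J x) = norm x" by simp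
qed

lemma proj_eqI:
  assumes J: "hilbert_extension J M" and h: "\<And>k. cinner m (J k) = cinner h k"
  shows "proj J m = h"
  unfolding proj_def
proof (rule the_equality)
  note J = hilbert_extension_isometry[OF J]
  show "\<forall>k. cinner (m - J h) (J k) = 0" by (simp add: cinner_diff_left J h)
  fix h' assume "\<forall>k. cinner (m - J h') (J k) = 0"
  then have "cinner (h - h') (h - h') = 0" by (simp add: cinner_diff_left J h)
  then show "h' = h" by simp
qed

lemma cinner_proj:
  fixes J :: "'h::chilbert_space \<Rightarrow> 'm::chilbert_space"
  assumes J: "hilbert_extension J M"
  shows "cinner m (J k) = cinner (proj J m) k"
proof -
  note Jl = hilbert_extension_isometry[OF J]
  have "\<exists>h\<in>UNIV. \<forall>k\<in>UNIV. cinner (J k) m = cinner k h"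
  proof (rule riesz_representation[OF cvs.subspace_UNIV closed_UNIV, where K = "norm m"])
    show "cmod (cinner (J k) m) \<le> norm m * norm k" for k
      using norm_cinner_le[of "J k" m] by (simp add: Jl mult.commute)
  qed (simp_all add: Jl cinner_simps)
  then obtain h where h: "cinner (J k) m = cinner k h" for k by blast
  have "cinner m (J k) = cinner h k" for k
    using h[of k] cinner_commute[of m "J k"] cinner_commute[of h k] by simp
  with proj_eqI[OF J] show ?thesis by metis
qed

text \<open>
  Split \<open>m = J (proj J m) + r\<close>. Since \<open>Q\<^sup>* Q r = r\<close>, the images \<open>Q J (proj J m)\<close> and \<open>Q r\<close> are
  again orthogonal and \<open>\<parallel>Q r\<parallel> = \<parallel>r\<parallel>\<close>. For \<open>m = Q J h\<close>, whose projection is \<open>T h\<close>, the remainder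
  contributes the same amount to \<open>\<parallel>Q m\<parallel>\<^sup>2\<close> and \<open>\<parallel>m\<parallel>\<^sup>2\<close>, which are equal for a quasi-isometry.
  Hence \<open>\<parallel>Q J T h\<parallel> = \<parallel>T h\<parallel>\<close>, and \<open>T (T h)\<close> is the projection of \<open>Q J T h\<close>.
\<close>

theorem quasicontraction_if_special_lifting:
  fixes T :: "'h::chilbert_space \<Rightarrow> 'h" and M :: "'m::chilbert_space set"
  assumes T: "bounded_op UNIV T" and lift: "special_lifting J M T Q"
  shows "quasicontraction UNIV T"
proof -
  have J: "hilbert_extension J M" and Q: "bounded_op M Q"
    and TQ: "\<And>m. m \<in> M \<Longrightarrow> proj J (Q m) = T (proj J m)"
    and qi: "quasi_isometry M Q"
    and ker: "\<And>m. m \<in> M \<Longrightarrow> (\<And>h. cinner m (J h) = 0) \<Longrightarrow> adj M Q (Q m) = m"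
    using lift unfolding special_lifting_def lifting_def ortho_compl_def kernel_op_def by auto
  note Jl = hilbert_extension_isometry[OF J]
  note M = Jl(5,6) and mem = bounded_op_mem[OF Q] cvs.subspace_diff[OF Jl(5)]
  have iso: "norm (Q (Q m)) = norm (Q m)" if "m \<in> M" for m
    using qi that unfolding quasi_isometry_iff[OF M Q] by blast
  have projJ: "proj J (J h) = h" for h by (rule proj_eqI[OF J]) (simp add: Jl)
  have decomp: "(norm m)\<^sup>2 = (norm (proj J m))\<^sup>2 + (norm (m - J (proj J m)))\<^sup>2"
      "(norm (Q m))\<^sup>2 = (norm (Q (J (proj J m))))\<^sup>2 + (norm (m - J (proj J m)))\<^sup>2"
    if m: "m \<in> M" for m
  proof -
    define p r where "p = J (proj J m)" and "r = m - p"
    have p: "p \<in> M" and r: "r \<in> M" and mpr: "m = p + r"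
      using m by (auto simp: p_def r_def Jl mem)
    have orth: "cinner r (J h) = 0" for h
      using cinner_proj[OF J, of m h] by (simp add: r_def p_def cinner_diff_left Jl)
    have "cinner (Q x) (Q r) = cinner x r" if "x \<in> M" for x
      using cinner_adj[OF M Q that, of "Q r"] ker[OF r orth] by simp
    then have Qpr: "cinner (Q p) (Q r) = cinner p r" and "cinner (Q r) (Q r) = cinner r r"
      using p r by auto
    then have Qr: "(norm (Q r))\<^sup>2 = (norm r)\<^sup>2" by (simp only: Re_cinner_self[symmetric])
    have pr: "cinner p r = 0"
      using orth[of "proj J m"] cinner_commute[of p r] by (simp add: p_def)
    have pyth: "(norm (a + b))\<^sup>2 = (norm a)\<^sup>2 + (norm b)\<^sup>2" if "cinner a b = 0" for a b :: 'm
      using that cinner_commute[of b a]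
      by (simp add: Re_cinner_self[symmetric] cinner_simps)
    have "norm p = norm (proj J m)" by (simp add: p_def Jl)
    then show "(norm m)\<^sup>2 = (norm (proj J m))\<^sup>2 + (norm (m - J (proj J m)))\<^sup>2"
      using pyth[OF pr] unfolding mpr[symmetric] r_def p_def by simp
    have "(norm (Q m))\<^sup>2 = (norm (Q p))\<^sup>2 + (norm r)\<^sup>2"
      using pyth[of "Q p" "Q r"] unfolding Qpr pr Qr bounded_op_add[OF Q p r, symmetric] mpr[symmetric]
      by simp
    then show "(norm (Q m))\<^sup>2 = (norm (Q (J (proj J m))))\<^sup>2 + (norm (m - J (proj J m)))\<^sup>2"
      unfolding r_def p_def .
  qed
  have "norm (T (T h)) \<le> norm (T h)" for h
  proof -
    have "proj J (Q (J h)) = T h" by (simp add: TQ Jl projJ)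
    then have "(norm (Q (J (T h))))\<^sup>2 = (norm (T h))\<^sup>2"
      using decomp[of "Q (J h)"] iso[of "J h"] by (simp add: Jl mem)
    moreover have "(norm (T (T h)))\<^sup>2 \<le> (norm (Q (J (T h))))\<^sup>2"
      using decomp(1)[of "Q (J (T h))"] by (simp add: Jl mem TQ projJ)
    ultimately show ?thesis by (intro power2_le_imp_le[OF _ norm_ge_zero]) simp
  qed
  then show ?thesis by (simp add: quasicontraction_iff[OF T])
qed

section \<open>Contractive extension of \<open>T\<close> from its range\<close>

text \<open>
  \<open>R = T P\<close> with \<open>P\<close> the projection onto the closure of the range of \<open>T\<close>, where \<open>T\<close> is contractive
  by continuity. The form in the last conclusion controls \<open>\<parallel>x - P x\<parallel>\<^sup>2\<close>, \<open>\<parallel>T x\<parallel>\<^sup>2\<close> and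
  \<open>\<parallel>P x\<parallel>\<^sup>2 - \<parallel>R x\<parallel>\<^sup>2\<close>, of which it is the sum; and \<open>\<parallel>R x\<parallel>\<close> is in turn controlled by the first
  two, as \<open>R x = T x - T (x - P x)\<close>. So it controls \<open>\<parallel>x\<parallel>\<^sup>2\<close>.
\<close>

lemma quasicontraction_range_contraction:
  fixes T :: "'a::chilbert_space \<Rightarrow> 'a"
  assumes T: "bounded_op UNIV T" and qc: "quasicontraction UNIV T"
  obtains R d where "bounded_op UNIV R" "\<And>x. norm (R x) \<le> norm x" "\<And>x. R (T x) = T (T x)"
    "0 < d" "\<And>x. d * (norm x)\<^sup>2 \<le> (norm x)\<^sup>2 + (norm (T x))\<^sup>2 - (norm (R x))\<^sup>2"
proof -
  define E where "E = closure (range T)"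
  have "csubspace (range T)"
    by (rule cvs.subspaceI)
      (auto simp: bounded_op_add[OF T, symmetric] bounded_op_scale[OF T, symmetric]
        intro: range_eqI[where x = 0] simp: linear_0[OF bounded_linear.linear[OF bounded_linear_if_bounded_op[OF T]]])
  then have E: "csubspace E" "closed E" by (auto simp: E_def closure_csubspace)
  obtain P where P: "\<And>y. P y \<in> E" "\<And>m y. m \<in> E \<Longrightarrow> cinner m (P y) = cinner m y"
    using ex_orthogonal_projection[OF E] by metis
  note mem = cvs.subspace_add[OF E(1)] cvs.subspace_scale[OF E(1)]
  have P_id: "P m = m" if "m \<in> E" for m
    by (rule cinner_ext_on[OF E(1)]) (simp_all add: P that)
  have pyth: "(norm x)\<^sup>2 = (norm (P x))\<^sup>2 + (norm (x - P x))\<^sup>2" for x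
  proof -
    have "cinner (P x) x = cinner (P x) (P x)" using P by simp
    moreover have "cinner x (P x) = cinner (P x) (P x)"
      using calculation by (metis cinner_commute)
    ultimately show ?thesis by (simp add: Re_cinner_self[symmetric] cinner_simps)
  qed
  have P_le: "norm (P x) \<le> norm x" for x
    by (rule power2_le_imp_le[OF _ norm_ge_zero]) (simp add: pyth[of x])
  have P_op: "bounded_op UNIV P"
    unfolding bounded_op_def
  proof (intro conjI ballI allI exI[of _ 1] UNIV_I)
    show "P (x + y) = P x + P y" for x y
      by (rule cinner_ext_on[OF E(1)]) (simp_all add: P mem cinner_simps)
    show "P (a *\<^sub>C x) = a *\<^sub>C P x" for a x
      by (rule cinner_ext_on[OF E(1)]) (simp_all add: P mem cinner_simps)
    show "norm (P x) \<le> 1 * norm x" for x using P_le by simp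
  qed
  have T_le: "norm (T u) \<le> norm u" if "u \<in> E" for u
  proof -
    have "continuous_on UNIV T"
      using bounded_linear_if_bounded_op[OF T] by (rule linear_continuous_on)
    then have "closed {u. norm (T u) \<le> norm u}"
      by (intro closed_Collect_le continuous_intros)
    then have "E \<subseteq> {u. norm (T u) \<le> norm u}"
      unfolding E_def using qc by (intro closure_minimal) (auto simp: quasicontraction_iff[OF T])
    then show ?thesis using that by auto
  qed
  obtain K where K: "K \<ge> 0" "\<And>x. norm (T x) \<le> K * norm x"
    using bounded_op_bound[OF T] by auto
  define R where "R x = T (P x)" for x
  \<comment> \<open>The inverse of the constant in the estimate of \<open>\<parallel>x\<parallel>\<^sup>2\<close> by the form, obtained below.\<close>
  define d where "d = 1 / (2 * K\<^sup>2 + 2)"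
  have "0 < 2 * K\<^sup>2 + 2" using zero_le_power2[of K] by linarith
  then have d: "d * (2 * K\<^sup>2 + 2) = 1" "0 < d" unfolding d_def by simp_all
  show ?thesis
  proof (rule that[of R d])
    show "bounded_op UNIV R" unfolding R_def by (rule bounded_op_compose[OF T P_op])
    show "norm (R x) \<le> norm x" for x
      unfolding R_def using T_le[OF P(1)[of x]] P_le[of x] by linarith
    show "R (T x) = T (T x)" for x
      unfolding R_def E_def[symmetric] using P_id[of "T x"] subsetD[OF closure_subset rangeI[of T x]]
      by (simp add: E_def)
    show "0 < d" by (rule d(2))
    show "d * (norm x)\<^sup>2 \<le> (norm x)\<^sup>2 + (norm (T x))\<^sup>2 - (norm (R x))\<^sup>2" for x
    proof -
      define v where "v = x - P x"
      have "R x = T x + T (- v)"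
        unfolding R_def v_def using bounded_op_add[OF T, of x "- (x - P x)"] by simp
      then have "(norm (R x))\<^sup>2 \<le> 2 * (norm (T x))\<^sup>2 + 2 * (norm (T (- v)))\<^sup>2"
        by (simp only: norm_add_square_le)
      also have "(norm (T (- v)))\<^sup>2 \<le> K\<^sup>2 * (norm v)\<^sup>2"
        using power_mono[OF K(2)[of "- v"] norm_ge_zero, of 2] by (simp add: power_mult_distrib)
      finally have Rx: "(norm (R x))\<^sup>2 \<le> 2 * (norm (T x))\<^sup>2 + 2 * (K\<^sup>2 * (norm v)\<^sup>2)" by simp
      define e where "e = (norm (P x))\<^sup>2 - (norm (R x))\<^sup>2"
      have e: "0 \<le> e" unfolding e_def R_def using T_le[OF P(1)[of x]] by (simp add: power_mono)
      \<comment> \<open>The bracket is the form at \<open>x\<close>, by the Pythagorean identity.\<close>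
      have "(norm x)\<^sup>2 \<le> (2 * K\<^sup>2 + 2) * (e + (norm v)\<^sup>2 + (norm (T x))\<^sup>2)"
      proof -
        have "0 \<le> K\<^sup>2 * e" "0 \<le> K\<^sup>2 * (norm (T x))\<^sup>2" using e by simp_all
        moreover have "(norm x)\<^sup>2 = e + (norm (R x))\<^sup>2 + (norm v)\<^sup>2"
          using pyth[of x] by (simp add: e_def v_def)
        moreover have "(2 * K\<^sup>2 + 2) * (e + (norm v)\<^sup>2 + (norm (T x))\<^sup>2) =
            2 * (K\<^sup>2 * e) + 2 * (K\<^sup>2 * (norm v)\<^sup>2) + 2 * (K\<^sup>2 * (norm (T x))\<^sup>2) +
            2 * e + 2 * (norm v)\<^sup>2 + 2 * (norm (T x))\<^sup>2"
          by (simp add: algebra_simps)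
        ultimately show ?thesis using Rx e zero_le_power2[of "norm v"] by linarith
      qed
      then have "d * (norm x)\<^sup>2 \<le> d * (2 * K\<^sup>2 + 2) * (e + (norm v)\<^sup>2 + (norm (T x))\<^sup>2)"
        using d(2) by (simp add: mult.assoc)
      then show ?thesis using pyth[of x] by (simp add: d(1) e_def v_def)
    qed
  qed
qed

section \<open>The operator inequality\<close>

lemma quasicontraction_if_op_le:
  fixes T A :: "'h::chilbert_space \<Rightarrow> 'h"
  assumes T: "bounded_op UNIV T"
    and eq: "adj UNIV T \<circ> T = adj UNIV T \<circ> A \<circ> T"
    and le: "op_le UNIV (adj UNIV T \<circ> A \<circ> T) A"
  shows "quasicontraction UNIV T"
proof -
  note adj = cinner_adj_left[OF cvs.subspace_UNIV closed_UNIV T UNIV_I]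
  have "norm (T (T h)) \<le> norm (T h)" for h
  proof -
    have "cinner (A (T h)) (T h) = cinner (T h) (T h)"
      using arg_cong[OF fun_cong[OF eq, of h], of "\<lambda>y. cinner y h"] by (simp add: adj)
    moreover have "0 \<le> Re (cinner (A (T h) - adj UNIV T (T (T h))) (T h))"
      using le unfolding eq[symmetric] op_le_def positive_op_def by simp
    ultimately have "(norm (T (T h)))\<^sup>2 \<le> (norm (T h))\<^sup>2"
      by (simp add: cinner_diff_left adj cinner_self flip: of_real_power)
    then show ?thesis by (rule power2_le_imp_le[OF _ norm_ge_zero])
  qed
  then show ?thesis by (simp add: quasicontraction_iff[OF T])
qed

text \<open>
  The witness is \<open>A = I + T\<^sup>* T - R\<^sup>* R\<close>. On the range of \<open>T\<close> the last two terms cancel in the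
  form, because \<open>R T = T T\<close>; and \<open>A - T\<^sup>* T = I - R\<^sup>* R\<close> is positive, because \<open>R\<close> is a contraction.
\<close>

lemma ex_op_le_if_quasicontraction:
  fixes T :: "'h::chilbert_space \<Rightarrow> 'h"
  assumes T: "bounded_op UNIV T" and qc: "quasicontraction UNIV T"
  shows "\<exists>A. invertible_op UNIV A \<and> adj UNIV T \<circ> T = adj UNIV T \<circ> A \<circ> T \<and>
    op_le UNIV (adj UNIV T \<circ> A \<circ> T) A"
proof -
  obtain R d where R: "bounded_op UNIV R" and R_le: "\<And>x. norm (R x) \<le> norm x"
    and RT: "\<And>x. R (T x) = T (T x)" and d: "0 < d"
    and coercive: "\<And>x. d * (norm x)\<^sup>2 \<le> (norm x)\<^sup>2 + (norm (T x))\<^sup>2 - (norm (R x))\<^sup>2"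
    by (rule quasicontraction_range_contraction[OF T qc]) blast
  note U = cvs.subspace_UNIV closed_UNIV
  note adjT = cinner_adj[OF U T UNIV_I] cinner_adj_left[OF U T UNIV_I]
    and adjR = cinner_adj[OF U R UNIV_I] cinner_adj_left[OF U R UNIV_I]
  define A where "A x = x + adj UNIV T (T x) - adj UNIV R (R x)" for x
  have form: "cinner x (A y) = cinner x y + cinner (T x) (T y) - cinner (R x) (R y)"
      "cinner (A x) y = cinner x y + cinner (T x) (T y) - cinner (R x) (R y)" for x y
    by (simp_all add: A_def cinner_simps adjT adjR)
  have A: "bounded_op UNIV A"
  proof -
    have lT: "bounded_op UNIV (\<lambda>x. adj UNIV T (T x))" and lR: "bounded_op UNIV (\<lambda>x. adj UNIV R (R x))"
      by (rule bounded_op_compose[OF bounded_op_adj[OF U T] T]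
          bounded_op_compose[OF bounded_op_adj[OF U R] R])+
    have "bounded_linear A"
      unfolding A_def
      by (intro bounded_linear_add bounded_linear_sub bounded_linear_ident
          bounded_linear_if_bounded_op lT lR)
    then obtain K where "\<And>x. norm (A x) \<le> norm x * K" using bounded_linear.bounded by blast
    then have "\<exists>K. \<forall>x. norm (A x) \<le> K * norm x" by (metis mult.commute)
    then show ?thesis
      unfolding bounded_op_def
      by (auto simp: A_def bounded_op_add[OF lT] bounded_op_add[OF lR] bounded_op_scale[OF lT]
          bounded_op_scale[OF lR] scaleC_add_right cvs.scale_right_diff_distrib)
  qed
  have inv: "invertible_op UNIV A"
    by (rule coercive_invertible[OF A _ d])
      (use coercive in \<open>simp_all add: form cinner_self\<close>)
  have eq: "adj UNIV T \<circ> T = adj UNIV T \<circ> A \<circ> T"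
  proof
    fix h
    show "(adj UNIV T \<circ> T) h = (adj UNIV T \<circ> A \<circ> T) h"
      by (rule cinner_ext_on[OF cvs.subspace_UNIV]) (simp_all add: adjT form RT)
  qed
  have "op_le UNIV (adj UNIV T \<circ> A \<circ> T) A"
    unfolding eq[symmetric] op_le_def positive_op_def
  proof
    fix x
    have "cinner (A x - (adj UNIV T \<circ> T) x) x = complex_of_real ((norm x)\<^sup>2 - (norm (R x))\<^sup>2)"
      by (simp add: cinner_diff_left form adjT cinner_self)
    then show "cinner (A x - (adj UNIV T \<circ> T) x) x \<in> \<real> \<and>
        0 \<le> Re (cinner (A x - (adj UNIV T \<circ> T) x) x)"
      using power_mono[OF R_le norm_ge_zero, of x 2] by simp
  qed
  then show ?thesis using inv eq by blast
qed


section \<open>Defects of contractions as sums of squares\<close>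

text \<open>
  The product of \<open>k\<close> factors, alternately \<open>F\<close> and \<open>G\<close>, with \<open>F\<close> applied first. Swapping the two
  arguments in the recursive call gives inductions over \<open>k\<close> without a distinction by parity.
\<close>

fun alternating_power :: "('a \<Rightarrow> 'a) \<Rightarrow> ('a \<Rightarrow> 'a) \<Rightarrow> nat \<Rightarrow> 'a \<Rightarrow> 'a" where
  "alternating_power F G 0 h = h"
| "alternating_power F G (Suc k) h = alternating_power G F k (F h)"

lemma bounded_op_alternating_power:
  assumes "bounded_op UNIV F" "bounded_op UNIV G"
  shows "bounded_op UNIV (alternating_power F G k)"
  using assms
proof (induction k arbitrary: F G)
  case 0
  have "alternating_power F G 0 = (\<lambda>h. h)" by (rule ext) simp
  then show ?case by (simp only: bounded_op_ident)
next
  case (Suc k)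
  have "alternating_power F G (Suc k) = (\<lambda>h. alternating_power G F k (F h))" by (rule ext) simp
  then show ?case using bounded_op_compose[OF Suc.IH[OF Suc.prems(2,1)] Suc.prems(1)] by simp
qed

lemma norm_alternating_power_Suc_le:
  assumes "\<And>x. norm (F x) \<le> norm x" "\<And>x. norm (G x) \<le> norm x"
  shows "norm (alternating_power F G (Suc k) h) \<le> norm (alternating_power F G k h)"
  using assms
proof (induction k arbitrary: F G h)
  case (Suc k)
  show ?case using Suc.IH[OF Suc.prems(2,1), of "F h"] by simp
qed simp

text \<open>
  With \<open>G = F\<^sup>*\<close> and \<open>s = G F\<close> both sides are \<open>\<langle>s\<^sup>k\<^sup>+\<^sup>1 h, h\<rangle>\<close>.
\<close>

lemma cinner_alternating_power:
  assumes "\<And>x y. cinner (F x) y = cinner x (G y)" "\<And>x y. cinner (G x) y = cinner x (F y)"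
  shows "cinner (alternating_power F G k h) (alternating_power F G k (G (F h))) =
    cinner (alternating_power F G (Suc k) h) (alternating_power F G (Suc k) h)"
  using assms
proof (induction k arbitrary: F G h)
  case (Suc k)
  show ?case using Suc.IH[OF Suc.prems(2,1), of "F h"] by simp
qed simp

text \<open>
  With \<open>s = F\<^sup>* F\<close> and \<open>a k = \<langle>s\<^sup>k h, h\<rangle>\<close> the \<open>k\<close>-th term is
  \<open>\<langle>s\<^sup>k (1 - s)\<^sup>2 h, h\<rangle> = a k - 2 a (k + 1) + a (k + 2)\<close>, a second difference. Since \<open>a\<close> is decreasing
  and nonnegative, its first differences tend to \<open>0\<close> and the series telescopes to \<open>a 0 - a 1\<close>.
\<close>

lemma alternating_power_defect_sums:
  fixes F :: "'a::chilbert_space \<Rightarrow> 'a"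
  assumes F: "bounded_op UNIV F" "\<And>x. norm (F x) \<le> norm x"
  defines "G \<equiv> adj UNIV F"
  shows "(\<lambda>k. (norm (alternating_power F G k (h - G (F h))))\<^sup>2) sums ((norm h)\<^sup>2 - (norm (F h))\<^sup>2)"
proof -
  note U = cvs.subspace_UNIV closed_UNIV
  have G: "bounded_op UNIV G" unfolding G_def by (rule bounded_op_adj[OF U F(1)])
  have G_le: "norm (G x) \<le> norm x" for x
    unfolding G_def using norm_adj_le[OF U F(1), of 1 x] F(2) by simp
  note adj = cinner_adj[OF U F(1) UNIV_I, symmetric, folded G_def]
    cinner_adj_left[OF U F(1) UNIV_I, folded G_def]
  define a where "a k = (norm (alternating_power F G k h))\<^sup>2" for k
  have step: "(norm (alternating_power F G k (h - G (F h))))\<^sup>2 =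
      (a k - a (Suc k)) - (a (Suc k) - a (Suc (Suc k)))" for k
  proof -
    let ?u = "alternating_power F G k h" and ?v = "alternating_power F G k (G (F h))"
    have "alternating_power F G k (h - G (F h)) = ?u - ?v"
      by (rule bounded_op_diff[OF bounded_op_alternating_power[OF F(1) G] cvs.subspace_UNIV])
        simp_all
    moreover have "Re (cinner ?u ?v) = a (Suc k)"
      using cinner_alternating_power[OF adj, of k h] unfolding a_def Re_cinner_self[symmetric] by simp
    moreover have "Re (cinner ?v ?u) = Re (cinner ?u ?v)"
      using cinner_commute[of ?v ?u] by simp
    moreover have "a (Suc (Suc k)) = Re (cinner ?v ?v)" "a k = Re (cinner ?u ?u)"
      by (simp_all add: a_def Re_cinner_self)
    ultimately show ?thesis by (simp add: Re_cinner_self[symmetric] cinner_simps)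
  qed
  have "decseq a"
    unfolding decseq_Suc_iff a_def
    using norm_alternating_power_Suc_le[OF F(2) G_le] by (blast intro: power_mono norm_ge_zero)
  then obtain l where l: "a \<longlonglongrightarrow> l"
    using decseq_convergent[of a 0] by (auto simp: a_def)
  then have "(\<lambda>k. a k - a (Suc k)) \<longlonglongrightarrow> l - l"
    by (intro tendsto_diff LIMSEQ_Suc)
  from telescope_sums'[OF this] show ?thesis
    unfolding step by (simp add: a_def)
qed

section \<open>The minimal lifting\<close>

text \<open>
  In matrix form, \<open>Q = (T, 0; D, V)\<close> for the splitting of a sequence into its entry \<open>0\<close> and the
  rest: \<open>V\<close> moves entry \<open>n > 0\<close> to entry \<open>2 n\<close>, which is isometric and leaves the odd entries free
  for \<open>D\<close>, the operator with \<open>D\<^sup>* D = I - R\<^sup>* R\<close> given by the series of alternating powers.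
\<close>

definition dilation :: "('h::chilbert_space \<Rightarrow> 'h) \<Rightarrow> ('h \<Rightarrow> 'h) \<Rightarrow> 'h ell2 \<Rightarrow> 'h ell2" where
  "dilation T R x = Abs_ell2 (\<lambda>n.
     if n = 0 then T (ell2_nth x 0)
     else if even n then ell2_nth x (n div 2)
     else alternating_power R (adj UNIV R) ((n - 1) div 2)
       (ell2_nth x 0 - adj UNIV R (R (ell2_nth x 0))))"

definition embed_first :: "'h::chilbert_space \<Rightarrow> 'h ell2" where
  "embed_first h = Abs_ell2 (\<lambda>n. if n = 0 then h else 0)"

lemma nth_embed_first [simp]: "ell2_nth (embed_first h) n = (if n = 0 then h else 0)"
proof -
  have "summable (\<lambda>n. (norm (if n = (0::nat) then h else 0))\<^sup>2)"
    by (rule summable_finite[of "{0}"]) auto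
  then show ?thesis by (simp add: embed_first_def Abs_ell2_inverse)
qed

lemma cinner_embed_first: "cinner m (embed_first h) = cinner (ell2_nth m 0) h"
proof -
  have "(\<lambda>n. if n = 0 then cinner (ell2_nth m 0) h else 0) sums cinner (ell2_nth m 0) h"
    by (rule sums_single)
  moreover have "(\<lambda>n. cinner (ell2_nth m n) (ell2_nth (embed_first h) n)) =
      (\<lambda>n. if n = 0 then cinner (ell2_nth m 0) h else 0)"
    by auto
  ultimately show ?thesis by (simp add: cinner_ell2_def sums_unique[symmetric])
qed

lemma clinear_embed_first: "clinear embed_first"
  unfolding Vector_Spaces.linear_iff by (auto simp: vector_space_scaleC intro!: ell2_eqI)

lemma hilbert_extension_embed_first:
  assumes "csubspace M" "closed M" "range embed_first \<subseteq> M"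
  shows "hilbert_extension embed_first M"
  using assms by (simp add: hilbert_extension_def clinear_embed_first cinner_embed_first)

lemma proj_embed_first:
  fixes M :: "'h::chilbert_space ell2 set" and m :: "'h ell2"
  assumes "hilbert_extension embed_first M"
  shows "proj embed_first m = ell2_nth m 0"
  by (rule proj_eqI[OF assms]) (rule cinner_embed_first)

locale range_contraction =
  fixes T R :: "'h::chilbert_space \<Rightarrow> 'h"
  assumes T: "bounded_op UNIV T" and R: "bounded_op UNIV R"
    and R_le: "norm (R x) \<le> norm x"
begin

abbreviation (input) "Q \<equiv> dilation T R"

lemma dilation_sums:
  "(\<lambda>n. (norm (if n = 0 then T (ell2_nth x 0)
     else if even n then ell2_nth x (n div 2)
     else alternating_power R (adj UNIV R) ((n - 1) div 2)
       (ell2_nth x 0 - adj UNIV R (R (ell2_nth x 0)))))\<^sup>2)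
   sums ((norm x)\<^sup>2 + (norm (T (ell2_nth x 0)))\<^sup>2 - (norm (R (ell2_nth x 0)))\<^sup>2)"
  (is "(\<lambda>n. (norm (?q n))\<^sup>2) sums _")
proof -
  define x0 where "x0 = ell2_nth x 0"
  \<comment> \<open>The square norms at the even places, including \<open>T x\<^sub>0\<close> in place of \<open>x\<^sub>0\<close>; \<open>g\<close> has those at the odd places.\<close>
  define f where "f n = (norm (ell2_nth x n))\<^sup>2 +
    (if n = 0 then (norm (T x0))\<^sup>2 - (norm x0)\<^sup>2 else 0)" for n
  define g where "g k = (norm (alternating_power R (adj UNIV R) k (x0 - adj UNIV R (R x0))))\<^sup>2" for k
  have "f sums ((norm x)\<^sup>2 + ((norm (T x0))\<^sup>2 - (norm x0)\<^sup>2))"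
    unfolding f_def norm_ell2_square
    by (intro sums_add sums_single summable_sums[OF summable_ell2])
  moreover have "g sums ((norm x0)\<^sup>2 - (norm (R x0))\<^sup>2)"
    unfolding g_def by (rule alternating_power_defect_sums[OF R R_le])
  ultimately have "(\<lambda>n. if even n then f (n div 2) else g ((n - 1) div 2)) sums
      (((norm x0)\<^sup>2 - (norm (R x0))\<^sup>2) + ((norm x)\<^sup>2 + ((norm (T x0))\<^sup>2 - (norm x0)\<^sup>2)))"
    using sums_if by blast
  moreover have "(\<lambda>n. if even n then f (n div 2) else g ((n - 1) div 2)) = (\<lambda>n. (norm (?q n))\<^sup>2)"
    by (auto simp: f_def g_def x0_def fun_eq_iff elim!: evenE)
  ultimately show ?thesis by (simp add: x0_def)
qed

lemma nth_dilation: "ell2_nth (Q x) n =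
    (if n = 0 then T (ell2_nth x 0)
     else if even n then ell2_nth x (n div 2)
     else alternating_power R (adj UNIV R) ((n - 1) div 2)
       (ell2_nth x 0 - adj UNIV R (R (ell2_nth x 0))))"
  unfolding dilation_def
  by (subst Abs_ell2_inverse) (use sums_summable[OF dilation_sums] in auto)

lemma norm_dilation:
  "(norm (Q x))\<^sup>2 = (norm x)\<^sup>2 + (norm (T (ell2_nth x 0)))\<^sup>2 - (norm (R (ell2_nth x 0)))\<^sup>2"
  unfolding norm_ell2_square[of "Q x"] nth_dilation
  by (rule sums_unique[OF dilation_sums, symmetric])

lemma bounded_op_dilation: "bounded_op UNIV Q"
proof -
  let ?G = "adj UNIV R"
  note G = bounded_op_adj[OF cvs.subspace_UNIV closed_UNIV R]
  note W = bounded_op_alternating_power[OF R G]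
  obtain K where K: "K \<ge> 0" "\<And>x. norm (T x) \<le> K * norm x"
    using bounded_op_bound[OF T] by auto
  have "norm (Q x) \<le> (1 + K) * norm x" for x
  proof (rule power2_le_imp_le)
    have "norm (T (ell2_nth x 0)) \<le> K * norm x"
      by (rule order_trans[OF K(2) mult_left_mono[OF norm_nth_le_ell2 K(1)]])
    then have "(norm (T (ell2_nth x 0)))\<^sup>2 \<le> (K * norm x)\<^sup>2" by (rule power_mono) simp
    then have "(norm (Q x))\<^sup>2 \<le> (norm x)\<^sup>2 + (K * norm x)\<^sup>2"
      unfolding norm_dilation using zero_le_power2[of "norm (R (ell2_nth x 0))"] by linarith
    also have "\<dots> \<le> ((1 + K) * norm x)\<^sup>2"
      using K(1) by (simp add: power2_eq_square algebra_simps)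
    finally show "(norm (Q x))\<^sup>2 \<le> ((1 + K) * norm x)\<^sup>2" .
  qed (use K in simp)
  moreover have "Q (x + y) = Q x + Q y" for x y
  proof (rule ell2_eqI)
    fix n
    have "ell2_nth (x + y) 0 - ?G (R (ell2_nth (x + y) 0)) =
        (ell2_nth x 0 - ?G (R (ell2_nth x 0))) + (ell2_nth y 0 - ?G (R (ell2_nth y 0)))"
      by (simp add: bounded_op_add[OF R] bounded_op_add[OF G])
    then show "ell2_nth (Q (x + y)) n = ell2_nth (Q x + Q y) n"
      unfolding nth_add[of "Q x" "Q y"] nth_dilation
      by (simp only: nth_add bounded_op_add[OF T] bounded_op_add[OF W] UNIV_I split: if_split) simp
  qed
  moreover have "Q (a *\<^sub>C x) = a *\<^sub>C Q x" for a x
  proof (rule ell2_eqI)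
    fix n
    have "ell2_nth (a *\<^sub>C x) 0 - ?G (R (ell2_nth (a *\<^sub>C x) 0)) =
        a *\<^sub>C (ell2_nth x 0 - ?G (R (ell2_nth x 0)))"
      by (simp add: bounded_op_scale[OF R] bounded_op_scale[OF G] cvs.scale_right_diff_distrib)
    then show "ell2_nth (Q (a *\<^sub>C x)) n = ell2_nth (a *\<^sub>C Q x) n"
      unfolding nth_scaleC[of a "Q x"] nth_dilation
      by (simp add: bounded_op_scale[OF T] bounded_op_scale[OF W])
  qed
  ultimately show ?thesis unfolding bounded_op_def by blast
qed

lemma cinner_dilation:
  "cinner (Q x) (Q y) = cinner x y + cinner (T (ell2_nth x 0)) (T (ell2_nth y 0))
     - cinner (R (ell2_nth x 0)) (R (ell2_nth y 0))"
proof -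
  note Q = bounded_op_dilation
  have "cinner (Q x) (Q y) - cinner x y - cinner (T (ell2_nth x 0)) (T (ell2_nth y 0))
     + cinner (R (ell2_nth x 0)) (R (ell2_nth y 0)) = 0"
    (is "?B x y = 0")
  proof (rule cinner_polarization[of UNIV ?B])
    show "?B z z = 0" for z
      using arg_cong[OF norm_dilation[of z], of complex_of_real] by (simp add: cinner_self)
  qed (simp_all add: cvs.subspace_UNIV bounded_op_add[OF Q] bounded_op_scale[OF Q]
      bounded_op_add[OF T] bounded_op_scale[OF T] bounded_op_add[OF R] bounded_op_scale[OF R]
      cinner_simps algebra_simps)
  then show ?thesis by (simp add: algebra_simps)
qed

end

text \<open>
  Since \<open>\<parallel>Q x\<parallel>\<^sup>2\<close> is \<open>\<parallel>x\<parallel>\<^sup>2\<close> plus a term in \<open>x\<^sub>0\<close>, all properties concern the coordinate \<open>x\<^sub>0\<close> and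
  pass to every closed invariant subspace \<open>M\<close> that contains the coordinate space. This freedom in
  \<open>M\<close> is what allows the lifting to be cut down to a minimal one.
\<close>

theorem special_lifting_dilation:
  fixes T R :: "'h::chilbert_space \<Rightarrow> 'h"
  assumes T: "bounded_op UNIV T" and R: "bounded_op UNIV R" and R_le: "\<And>x. norm (R x) \<le> norm x"
    and RT: "\<And>x. R (T x) = T (T x)"
    and d: "0 < d" and coercive: "\<And>x. d * (norm x)\<^sup>2 \<le> (norm x)\<^sup>2 + (norm (T x))\<^sup>2 - (norm (R x))\<^sup>2"
    and M: "csubspace M" "closed M" "range embed_first \<subseteq> M" "dilation T R ` M \<subseteq> M"
  shows "special_lifting embed_first M T (dilation T R)"
proof -
  interpret range_contraction T R by (unfold_locales) (fact T R R_le)+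
  note J = hilbert_extension_embed_first[OF M(1-3)]
  have Q: "bounded_op M Q" by (rule bounded_op_subset[OF bounded_op_dilation M(4)])
  have lift: "lifting embed_first M T Q"
    unfolding lifting_def using J Q by (simp add: proj_embed_first[OF J] nth_dilation)
  \<comment> \<open>\<open>\<parallel>Q x\<parallel>\<^sup>2\<close> is at least \<open>d \<parallel>x\<^sub>0\<parallel>\<^sup>2\<close> plus the square norms of the other entries, whence the minimum with \<open>1\<close>.\<close>
  define e where "e = min d 1"
  have e: "0 < e" "e \<le> d" "e \<le> 1" using d by (auto simp: e_def)
  have below: "sqrt e * norm x \<le> norm (Q x)" for x
  proof (rule power2_le_imp_le)
    let ?x = "ell2_nth x 0"
    have "(norm ?x)\<^sup>2 \<le> (norm x)\<^sup>2" by (rule power_mono[OF norm_nth_le_ell2]) simp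
    then have "0 \<le> (1 - e) * ((norm x)\<^sup>2 - (norm ?x)\<^sup>2)" using e by simp
    moreover have "e * (norm ?x)\<^sup>2 \<le> d * (norm ?x)\<^sup>2" using e by (simp add: mult_right_mono)
    ultimately have "e * (norm x)\<^sup>2 \<le> (norm (Q x))\<^sup>2"
      unfolding norm_dilation using coercive[of ?x] by (simp add: algebra_simps)
    then show "(sqrt e * norm x)\<^sup>2 \<le> (norm (Q x))\<^sup>2" using e by (simp add: power_mult_distrib)
  qed simp
  have lin: "bounded_linear Q" by (rule bounded_linear_if_bounded_op[OF bounded_op_dilation])
  have sub: "subspace M"
    unfolding subspace_def scaleR_scaleC
    using cvs.subspace_0[OF M(1)] cvs.subspace_add[OF M(1)] cvs.subspace_scale[OF M(1)] by blast
  have "inj_on Q M"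
  proof (rule inj_onI)
    fix x y assume "Q x = Q y"
    then have "Q (x - y) = 0"
      using bounded_op_diff[OF bounded_op_dilation cvs.subspace_UNIV UNIV_I UNIV_I] by simp
    then show "x = y" using below[of "x - y"] e by (simp add: mult_le_0_iff)
  qed
  moreover have "closed (Q ` M)"
    using complete_isometric_image[OF _ sub lin, of "sqrt e"] below e M(2)
    by (simp add: complete_eq_closed)
  moreover have "quasi_isometry M Q"
    unfolding quasi_isometry_iff[OF M(1,2) Q]
  proof
    fix x assume "x \<in> M"
    \<comment> \<open>The entry \<open>0\<close> of \<open>Q x\<close> is in the range of \<open>T\<close>, where \<open>R\<close> and \<open>T\<close> agree.\<close>
    have "(norm (Q (Q x)))\<^sup>2 = (norm (Q x))\<^sup>2"
      unfolding norm_dilation[of "Q x"] by (simp add: nth_dilation RT)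
    then show "norm (Q (Q x)) = norm (Q x)" by simp
  qed
  moreover have "ortho_compl embed_first M \<subseteq> kernel_op M (\<lambda>x. (adj M Q \<circ> Q) x - x)"
  proof
    fix m assume "m \<in> ortho_compl embed_first M"
    then have m: "m \<in> M" and "cinner (ell2_nth m 0) (ell2_nth m 0) = 0"
      by (auto simp: ortho_compl_def cinner_embed_first simp del: cinner_eq_zero_iff)
    then have m0: "ell2_nth m 0 = 0" by simp
    have "adj M Q (Q m) = m"
      using bounded_op_scale[OF T UNIV_I, of 0 0] bounded_op_scale[OF R UNIV_I, of 0 0]
      by (intro adj_unique[OF M(1) m]) (simp add: cinner_dilation m0)
    then show "m \<in> kernel_op M (\<lambda>x. (adj M Q \<circ> Q) x - x)" by (simp add: kernel_op_def m)
  qed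
  ultimately show ?thesis unfolding special_lifting_def left_invertible_def using lift by blast
qed

lemma closed_orbit_span_invariant:
  fixes Q :: "'a::complex_inner \<Rightarrow> 'a" and S :: "'a set"
  assumes Q: "bounded_op UNIV Q"
  defines "M \<equiv> closure (cspan (\<Union>n. (Q ^^ n) ` S))"
  shows "csubspace M" "closed M" "S \<subseteq> M" "Q ` M \<subseteq> M"
proof -
  let ?B = "\<Union>n. (Q ^^ n) ` S"
  show "csubspace M" unfolding M_def by (rule closure_csubspace[OF cvs.subspace_span])
  show "closed M" by (simp add: M_def)
  have "S \<subseteq> ?B" by (rule order_trans[OF _ UN_upper[of 0]]) auto
  then show "S \<subseteq> M"
    unfolding M_def using cvs.span_superset closure_subset by blast
  have "Q ` cspan ?B \<subseteq> cspan ?B"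
  proof
    fix y assume "y \<in> Q ` cspan ?B"
    then obtain x where x: "x \<in> cspan ?B" and y: "y = Q x" by blast
    have "Q x \<in> cspan ?B"
      using x
    proof (induction rule: cvs.span_induct_alt)
      case base
      then show ?case using bounded_op_scale[OF Q UNIV_I, of 0 0] cvs.span_zero by simp
    next
      case (step c x y)
      then obtain n s where "s \<in> S" "x = (Q ^^ n) s" by blast
      then have "Q x = (Q ^^ Suc n) s" by simp
      then have "Q x \<in> ?B" using \<open>s \<in> S\<close> by blast
      then show ?case
        using step.IH by (simp add: bounded_op_add[OF Q] bounded_op_scale[OF Q] cvs.span_add
            cvs.span_scale cvs.span_base)
    qed
    then show "y \<in> cspan ?B" by (simp add: y)
  qed
  then show "Q ` M \<subseteq> M"
    unfolding M_def
    using closure_bounded_linear_image_subset[OF bounded_linear_if_bounded_op[OF Q], of "cspan ?B"]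
      closure_mono[of "Q ` cspan ?B" "cspan ?B"]
    by blast
qed

theorem ex_minimal_special_lifting:
  fixes T :: "'h::chilbert_space \<Rightarrow> 'h"
  assumes T: "bounded_op UNIV T" and qc: "quasicontraction UNIV T"
  shows "\<exists>(M :: 'h ell2 set) J Q. special_lifting J M T Q \<and> minimal_lifting J M T Q"
proof -
  obtain R d where props: "bounded_op UNIV R" "\<And>x. norm (R x) \<le> norm x" "\<And>x. R (T x) = T (T x)"
    "0 < d" "\<And>x. d * (norm x)\<^sup>2 \<le> (norm x)\<^sup>2 + (norm (T x))\<^sup>2 - (norm (R x))\<^sup>2"
    by (rule quasicontraction_range_contraction[OF T qc]) blast
  interpret range_contraction T R by unfold_locales (fact T props)+
  let ?M = "closure (cspan (\<Union>n. (Q ^^ n) ` range embed_first))"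
  have "special_lifting embed_first ?M T Q"
    by (rule special_lifting_dilation[OF T props closed_orbit_span_invariant[OF bounded_op_dilation]])
  then show ?thesis unfolding minimal_lifting_def special_lifting_def by blast
qed

theorem theorem2p5:
  fixes T :: "'h::chilbert_space \<Rightarrow> 'h"
  assumes "bounded_op UNIV T"
  shows
    "(quasicontraction UNIV T \<longleftrightarrow>
        (\<exists>(M :: 'h ell2 set) J Q. special_lifting J M T Q)) \<and>
     ((\<exists>(M :: 'm::chilbert_space set) J Q. special_lifting J M T Q) \<longrightarrow> quasicontraction UNIV T) \<and>
     (quasicontraction UNIV T \<longleftrightarrow>
        (\<exists>A. invertible_op UNIV A \<and>
             adj UNIV T \<circ> T = adj UNIV T \<circ> A \<circ> T \<and>
             op_le UNIV (adj UNIV T \<circ> A \<circ> T) A)) \<and>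
     (quasicontraction UNIV T \<longrightarrow>
        (\<exists>(M :: 'h ell2 set) J Q. special_lifting J M T Q \<and> minimal_lifting J M T Q))"
proof (intro conjI)
  show "(\<exists>(M :: 'm set) J Q. special_lifting J M T Q) \<longrightarrow> quasicontraction UNIV T"
    using quasicontraction_if_special_lifting[OF assms] by blast
  show "quasicontraction UNIV T \<longleftrightarrow> (\<exists>(M :: 'h ell2 set) J Q. special_lifting J M T Q)"
    using quasicontraction_if_special_lifting[OF assms] ex_minimal_special_lifting[OF assms] by blast
qed (use quasicontraction_if_op_le[OF assms] ex_op_le_if_quasicontraction[OF assms]
    ex_minimal_special_lifting[OF assms] in blast)+

end
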